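(* Let $I\subset\mathbb{R}$ be an open interval and let $x,y,r:I\to\mathbb{R}$ be smooth functions with $r(s)>0$ and $x'(s)^2+y'(s)^2+r'(s)^2=1$ for all $s\in I$ (so $s$ is an arc-length parameter of the profile curve $\gamma(s)=(x(s),y(s),r(s))$ in $\mathbb{E}^3$). Consider the simple rotational surface in the four-dimensional Euclidean space $\mathbb{E}^4$ given by \[ X(s,\theta)=\bigl(x(s),\,y(s),\,r(s)\cos\theta,\,r(s)\sin\theta\bigr),\qquad (s,\theta)\in I\times\mathbb{R}. \] If the surface is biharmonic, i.e. its mean curvature vector $\mathbf{H}$ satisfies $\Delta\mathbf{H}=0$, then the surface is minimal, i.e. $\mathbf{H}\equiv 0$.
   Context: The surface carries the induced metric $g=ds^2+r(s)^2d\theta^2$, and $\Delta$ denotes its Laplace–Beltrami operator acting componentwise on $\mathbb{E}^4$-valued functions: $\Delta Y=\frac1r\partial_s(r\,\partial_sY)+\frac1{r^2}\partial_\theta^2Y$. The mean curvature vector is $\mathbf{H}=\frac12\Delta X$. Biharmonic means $\Delta\mathbf{H}=0$ identically on the surface; no completeness or properness of the immersion is assumed (the statement is local). *)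

theory Defs
  imports "HOL-Analysis.Analysis"
begin

definition smooth_on :: "real set \<Rightarrow> (real \<Rightarrow> real) \<Rightarrow> bool" where
  "smooth_on I f \<longleftrightarrow> (\<forall>n. \<forall>t\<in>I. ((deriv ^^ n) f) differentiable (at t))"

text \<open>Laplace-Beltrami operator of g = ds^2 + r(s)^2 d theta^2 on a scalar function Y(s,theta):
  (1/r) d/ds (r dY/ds) + (1/r^2) d^2Y/dtheta^2.\<close>
definition lap_scalar :: "(real \<Rightarrow> real) \<Rightarrow> (real \<Rightarrow> real \<Rightarrow> real) \<Rightarrow> real \<Rightarrow> real \<Rightarrow> real" where
  "lap_scalar r Y s \<theta> =
     (1 / r s) * deriv (\<lambda>t. r t * deriv (\<lambda>u. Y u \<theta>) t) s
     + (1 / (r s)^2) * deriv (deriv (\<lambda>\<phi>. Y s \<phi>)) \<theta>"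

definition lap :: "(real \<Rightarrow> real) \<Rightarrow> (real \<Rightarrow> real \<Rightarrow> real^4) \<Rightarrow> real \<Rightarrow> real \<Rightarrow> real^4" where
  "lap r Y s \<theta> = (\<chi> i. lap_scalar r (\<lambda>u \<phi>. Y u \<phi> $ i) s \<theta>)"

definition rot_surface :: "(real \<Rightarrow> real) \<Rightarrow> (real \<Rightarrow> real) \<Rightarrow> (real \<Rightarrow> real) \<Rightarrow> real \<Rightarrow> real \<Rightarrow> real^4" where
  "rot_surface x y r s \<theta> = vector [x s, y s, r s * cos \<theta>, r s * sin \<theta>]"

definition mean_curv :: "(real \<Rightarrow> real) \<Rightarrow> (real \<Rightarrow> real) \<Rightarrow> (real \<Rightarrow> real) \<Rightarrow> real \<Rightarrow> real \<Rightarrow> real^4" where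
  "mean_curv x y r s \<theta> = (1/2) *\<^sub>R lap r (rot_surface x y r) s \<theta>"

end

theory Submission
  imports Defs "HOL-Complex_Analysis.Complex_Analysis" "HOL-Real_Asymp.Real_Asymp"
    "HOL-Computational_Algebra.Polynomial_Factorial" "HOL-Computational_Algebra.Field_as_Ring"
    "HOL-Computational_Algebra.Fundamental_Theorem_Algebra"
begin

text \<open>Put \<open>D = r d/ds\<close>, the derivative in the conformal parameter \<open>t\<close>, and let \<open>(a, b, c)\<close> be twice
  the mean curvature vector. Biharmonicity says \<open>D^2 a = D^2 b = 0\<close> and \<open>D^2 c = c\<close>, so \<open>a\<close>, \<open>b\<close> are
  affine in \<open>t\<close> and \<open>c = C exp t + C' exp (-t)\<close>. Differentiating the orthogonality of \<open>(a, b, c)\<close> and the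
  profile velocity twice expresses \<open>D r\<close> rationally through \<open>r\<close>, \<open>t\<close> and \<open>exp t\<close>; combined with
  \<open>D^2 r = r + r^2 c\<close> this gives a quartic equation for \<open>q = r c\<close>, and differentiating the quartic gives
  a second polynomial equation. The resultant of the two is analytic in \<open>t\<close> and vanishes on an interval, hence
  everywhere, so the two polynomials have a common complex root for every large \<open>t\<close>. If \<open>C \<noteq> 0\<close>, such
  a root must tend to 0, and its rate of decay is incompatible with the two equations. Reflecting \<open>t\<close>
  gives \<open>C' = 0\<close> as well. Once \<open>c = 0\<close>, the quadratic polynomial \<open>a^2 + b^2\<close> in \<open>t\<close> satisfies a
  differential equation whose only polynomial solution is 0.\<close>

subsection \<open>Common roots and the Sylvester determinant\<close>

definition shifted_row :: "nat \<Rightarrow> real poly \<Rightarrow> real poly \<Rightarrow> nat \<Rightarrow> real poly" where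
  "shifted_row n p q i = (if i < n then monom 1 i * p else monom 1 (i - n) * q)"

text \<open>A Sylvester matrix whose size is an a priori degree bound, so that it depends polynomially on the
  coefficients; \<open>h\<close> enumerates the index type.\<close>

definition sylvester :: "('n::finite \<Rightarrow> nat) \<Rightarrow> nat \<Rightarrow> real poly \<Rightarrow> real poly \<Rightarrow> real^'n^'n" where
  "sylvester h n p q = (\<chi> i j. coeff (shifted_row n p q (h i)) (h j))"

lemma degree_shifted_row:
  assumes "degree p \<le> m" "degree q \<le> n" "i < m + n"
  shows "degree (shifted_row n p q i) < m + n"
proof (cases "i < n")
  case True
  have "degree (monom (1::real) i * p) \<le> i + degree p"
    using degree_mult_le[of "monom (1::real) i" p] by (simp add: degree_monom_eq)
  with True assms show ?thesis by (simp add: shifted_row_def)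
next
  case False
  have "degree (monom (1::real) (i - n) * q) \<le> (i - n) + degree q"
    using degree_mult_le[of "monom (1::real) (i - n)" q] by (simp add: degree_monom_eq)
  with False assms show ?thesis by (simp add: shifted_row_def)
qed

text \<open>The powers of a common root \<open>z\<close> form a vector annihilated by every row; its
  entry at exponent 0 is 1, so the matrix is singular.\<close>

lemma det_sylvester_common_root:
  fixes h :: "'n::finite \<Rightarrow> nat"
  assumes h: "bij_betw h UNIV {..<m + n}" and p: "degree p \<le> m" and q: "degree q \<le> n"
    and z: "poly p z = 0" "poly q z = 0"
  shows "det (sylvester h n p q) = 0"
proof (rule ccontr)
  let ?A = "sylvester h n p q"
  assume "det ?A \<noteq> 0"
  then have inj: "inj (\<lambda>x. ?A *v x)"
    using invertible_det_nz inj_matrix_vector_mult by blast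
  define v where "v = (\<chi> j. z ^ h j)"
  have "(?A *v v) $ i = 0" for i
  proof -
    have hi: "h i < m + n"
      using h by (auto simp: bij_betw_def)
    let ?f = "shifted_row n p q (h i)"
    have "(?A *v v) $ i = (\<Sum>j\<in>UNIV. coeff ?f (h j) * z ^ h j)"
      by (simp add: matrix_vector_mult_def sylvester_def v_def)
    also have "\<dots> = (\<Sum>k<m + n. coeff ?f k * z ^ k)"
      by (rule sum.reindex_bij_betw[OF h, of "\<lambda>k. coeff ?f k * z ^ k"])
    also have "\<dots> = (\<Sum>k\<le>degree ?f. coeff ?f k * z ^ k)"
      by (rule sum.mono_neutral_right)
        (use degree_shifted_row[OF p q hi] in \<open>auto intro!: coeff_eq_0\<close>)
    also have "\<dots> = poly ?f z"
      by (simp add: poly_altdef)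
    also have "\<dots> = 0"
      using z by (simp add: shifted_row_def)
    finally show ?thesis .
  qed
  then have "?A *v v = ?A *v 0"
    by (simp add: vec_eq_iff)
  then have v0: "v = 0"
    using inj by (simp add: inj_def)
  obtain j where "h j = 0"
  proof -
    have "h undefined < m + n"
      using h by (auto simp: bij_betw_def)
    then have "0 \<in> h ` UNIV"
      using h by (auto simp: bij_betw_def)
    then show ?thesis using that by (auto simp: image_iff)
  qed
  then have "v $ j = 1" by (simp add: v_def)
  with v0 show False by simp
qed

lemma map_poly_of_real_mult:
  "map_poly of_real (p * q) = (map_poly of_real p * map_poly of_real q :: complex poly)"
  by (rule poly_eqI) (simp add: coeff_map_poly coeff_mult)

text \<open>A dependency between the rows reads \<open>U * p + V * q = 0\<close> with
  \<open>U\<close> supported on exponents below \<open>n\<close> and \<open>V\<close> on exponents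
  below \<open>m\<close>. If \<open>p\<close> and \<open>q\<close> were coprime, \<open>p\<close>
  would divide \<open>V\<close>; since \<open>p\<close> has degree exactly \<open>m\<close>, this
  forces \<open>V = 0\<close> and then \<open>U = 0\<close>. So the real gcd is nonconstant and has
  a complex root.\<close>

lemma common_complex_root_of_det_sylvester:
  fixes h :: "'n::finite \<Rightarrow> nat"
  assumes h: "bij_betw h UNIV {..<m + n}" and p: "degree p = m" "p \<noteq> 0" and q: "degree q \<le> n"
    and det: "det (sylvester h n p q) = 0"
  obtains z :: complex where "poly (map_poly of_real p) z = 0" "poly (map_poly of_real q) z = 0"
proof -
  let ?A = "sylvester h n p q"
  let ?r = "shifted_row n p q"
  have "\<not> invertible (transpose ?A)"
    using det invertible_det_nz[of "transpose ?A"] by simp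
  then obtain v where v: "v \<noteq> 0" "transpose ?A *v v = 0"
    using invertible_left_inverse[of "transpose ?A"] matrix_left_invertible_ker[of "transpose ?A"] by auto
  define w where "w k = v $ inv_into UNIV h k" for k
  have w: "w (h i) = v $ i" for i
    using h by (simp add: w_def bij_betw_def inv_into_f_f)
  have "(\<Sum>k<m + n. smult (w k) (?r k)) = 0" (is "?s = 0")
  proof (rule poly_eqI)
    fix l
    show "coeff ?s l = coeff 0 l"
    proof (cases "l < m + n")
      case True
      then have "l \<in> range h"
        using h by (simp add: bij_betw_def)
      then obtain j where j: "h j = l"
        by blast
      have "coeff ?s l = (\<Sum>k<m + n. w k * coeff (?r k) l)"
        by (simp add: coeff_sum)
      also have "\<dots> = (\<Sum>i\<in>UNIV. w (h i) * coeff (?r (h i)) l)"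
        by (rule sum.reindex_bij_betw[OF h, symmetric, of "\<lambda>k. w k * coeff (?r k) l"])
      also have "\<dots> = (transpose ?A *v v) $ j"
        by (simp add: matrix_vector_mult_def transpose_def sylvester_def w j mult.commute)
      finally show ?thesis using v by simp
    next
      case False
      have "coeff (?r k) l = 0" if "k < m + n" for k
        by (rule coeff_eq_0) (use degree_shifted_row[of p m q n k] p q that False in auto)
      then show ?thesis by (simp add: coeff_sum)
    qed
  qed
  moreover
  define U where "U = (\<Sum>k<n. monom (w k) k)"
  define V where "V = (\<Sum>k<m. monom (w (n + k)) k)"
  have "?s = (\<Sum>k<n. smult (w k) (?r k)) + (\<Sum>k=n..<n + m. smult (w k) (?r k))"
    by (simp add: lessThan_atLeast0 sum.atLeastLessThan_concat add.commute)
  also have "(\<Sum>k=n..<n + m. smult (w k) (?r k)) = (\<Sum>k<m. smult (w (n + k)) (?r (n + k)))"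
    using sum.shift_bounds_nat_ivl[of "\<lambda>k. smult (w k) (?r k)" 0 n m]
    by (simp add: lessThan_atLeast0 add.commute)
  also have "(\<Sum>k<n. smult (w k) (?r k)) = U * p"
    by (simp add: U_def shifted_row_def sum_distrib_right smult_monom flip: mult_smult_left)
  also have "(\<Sum>k<m. smult (w (n + k)) (?r (n + k))) = V * q"
    by (simp add: V_def shifted_row_def sum_distrib_right smult_monom flip: mult_smult_left)
  ultimately have UV: "U * p + V * q = 0" by simp
  have cU: "coeff U k = (if k < n then w k else 0)" for k
    by (simp add: U_def coeff_sum)
  have cV: "coeff V k = (if k < m then w (n + k) else 0)" for k
    by (simp add: V_def coeff_sum)
  have "degree (gcd p q) > 0"
  proof (rule ccontr)
    assume "\<not> degree (gcd p q) > 0"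
    moreover have "gcd p q \<noteq> 0"
      using p by simp
    ultimately have "is_unit (gcd p q)"
      using is_unit_iff_degree by blast
    then have cop: "coprime p q"
      using is_unit_gcd by blast
    have "V * q = p * (- U)"
      using UV by (simp add: algebra_simps eq_neg_iff_add_eq_0)
    then have "p dvd V * q" by simp
    then have "p dvd V"
      using cop by (simp add: coprime_dvd_mult_left_iff)
    have "V = 0"
    proof (rule ccontr)
      assume V: "V \<noteq> 0"
      then have "m \<le> degree V"
        using dvd_imp_degree_le[OF \<open>p dvd V\<close>] p by simp
      then have "coeff V (degree V) = 0" by (simp add: cV)
      with V show False by simp
    qed
    then have "U = 0" using UV p by simp
    have "w k = 0" if "k < m + n" for k
    proof (cases "k < n")
      case True
      with cU[of k] \<open>U = 0\<close> show ?thesis by simp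
    next
      case False
      with that have "k - n < m" "n + (k - n) = k" by simp_all
      with cV[of "k - n"] \<open>V = 0\<close> show ?thesis by simp
    qed
    moreover have "h i < m + n" for i
      using h by (auto simp: bij_betw_def)
    ultimately have "v $ i = 0" for i
      using w[of i] by simp
    with v show False by (simp add: vec_eq_iff)
  qed
  then have "\<not> constant (poly (map_poly of_real (gcd p q)) :: complex \<Rightarrow> complex)"
    by (simp add: constant_degree degree_map_poly)
  then obtain z :: complex where z: "poly (map_poly of_real (gcd p q)) z = 0"
    using fundamental_theorem_of_algebra by blast
  have *: "poly (map_poly of_real u) z = 0" if "gcd p q dvd u" for u
  proof -
    from that obtain s where "u = gcd p q * s" by (rule dvdE)
    then have "map_poly (of_real :: real \<Rightarrow> complex) u = map_poly of_real (gcd p q) * map_poly of_real s"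
      by (simp add: map_poly_of_real_mult)
    with z show ?thesis by simp
  qed
  show ?thesis
    by (rule that[OF * *]) simp_all
qed

subsection \<open>Analytic continuation of common roots\<close>

text \<open>Functions that become restrictions of entire functions after multiplication by a power of \<open>c\<close>;
  their values at zeros of \<open>c\<close> are irrelevant.\<close>

definition entire_up_to :: "(real \<Rightarrow> real) \<Rightarrow> (real \<Rightarrow> real) \<Rightarrow> bool" where
  "entire_up_to c f \<longleftrightarrow> (\<exists>n F. F holomorphic_on UNIV \<and>
     (\<forall>t. c t \<noteq> 0 \<longrightarrow> F (complex_of_real t) = of_real (c t ^ n * f t)))"

lemma entire_up_to_holomorphic:
  assumes "F holomorphic_on UNIV" "\<And>t. F (complex_of_real t) = of_real (f t)"
  shows "entire_up_to c f"
  unfolding entire_up_to_def by (intro exI[of _ 0] exI[of _ F]) (use assms in auto)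

lemma entire_up_to_const: "entire_up_to c (\<lambda>t. a)"
  by (rule entire_up_to_holomorphic[of "\<lambda>z. of_real a"]) auto

locale entire_denominator =
  fixes c :: "real \<Rightarrow> real" and G :: "complex \<Rightarrow> complex"
  assumes G: "G holomorphic_on UNIV" "\<And>t. G (complex_of_real t) = of_real (c t)"
begin

lemma entire_up_to_mult:
  assumes "entire_up_to c f" "entire_up_to c g"
  shows "entire_up_to c (\<lambda>t. f t * g t)"
proof -
  obtain n F where F: "F holomorphic_on UNIV" "\<And>t. c t \<noteq> 0 \<Longrightarrow> F (of_real t) = of_real (c t ^ n * f t)"
    using assms(1) unfolding entire_up_to_def by blast
  obtain m H where H: "H holomorphic_on UNIV" "\<And>t. c t \<noteq> 0 \<Longrightarrow> H (of_real t) = of_real (c t ^ m * g t)"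
    using assms(2) unfolding entire_up_to_def by blast
  show ?thesis
    unfolding entire_up_to_def
    by (intro exI[of _ "n + m"] exI[of _ "\<lambda>z. F z * H z"])
      (use F H in \<open>auto intro!: holomorphic_intros simp: power_add\<close>)
qed

text \<open>The summands may need different powers of \<open>c\<close>, so each extension is
  multiplied by the power of \<open>G\<close>, the extension of \<open>c\<close>, that belongs to
  the other.\<close>

lemma entire_up_to_add:
  assumes "entire_up_to c f" "entire_up_to c g"
  shows "entire_up_to c (\<lambda>t. f t + g t)"
proof -
  obtain n F where F: "F holomorphic_on UNIV" "\<And>t. c t \<noteq> 0 \<Longrightarrow> F (of_real t) = of_real (c t ^ n * f t)"
    using assms(1) unfolding entire_up_to_def by blast
  obtain m H where H: "H holomorphic_on UNIV" "\<And>t. c t \<noteq> 0 \<Longrightarrow> H (of_real t) = of_real (c t ^ m * g t)"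
    using assms(2) unfolding entire_up_to_def by blast
  show ?thesis
    unfolding entire_up_to_def
    by (intro exI[of _ "n + m"] exI[of _ "\<lambda>z. G z ^ m * F z + G z ^ n * H z"])
      (use F H G in \<open>auto intro!: holomorphic_intros simp: power_add algebra_simps\<close>)
qed

lemma entire_up_to_divide:
  assumes "entire_up_to c f"
  shows "entire_up_to c (\<lambda>t. f t / c t)"
proof -
  obtain n F where F: "F holomorphic_on UNIV" "\<And>t. c t \<noteq> 0 \<Longrightarrow> F (of_real t) = of_real (c t ^ n * f t)"
    using assms unfolding entire_up_to_def by blast
  then show ?thesis
    unfolding entire_up_to_def by (intro exI[of _ "Suc n"] exI[of _ F]) auto
qed

lemma entire_up_to_uminus: "entire_up_to c f \<Longrightarrow> entire_up_to c (\<lambda>t. - f t)"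
  using entire_up_to_mult[OF entire_up_to_const[of c "-1"], of f] by simp

lemma entire_up_to_diff:
  "entire_up_to c f \<Longrightarrow> entire_up_to c g \<Longrightarrow> entire_up_to c (\<lambda>t. f t - g t)"
  using entire_up_to_add[of f "\<lambda>t. - g t"] entire_up_to_uminus[of g] by simp

lemma entire_up_to_power: "entire_up_to c f \<Longrightarrow> entire_up_to c (\<lambda>t. f t ^ n)"
  by (induction n) (auto intro: entire_up_to_mult entire_up_to_const)

lemma entire_up_to_sum:
  "(\<And>i. i \<in> A \<Longrightarrow> entire_up_to c (f i)) \<Longrightarrow> entire_up_to c (\<lambda>t. \<Sum>i\<in>A. f i t)"
  by (induction A rule: infinite_finite_induct) (auto intro: entire_up_to_add entire_up_to_const)

lemma entire_up_to_prod:
  "(\<And>i. i \<in> A \<Longrightarrow> entire_up_to c (f i)) \<Longrightarrow> entire_up_to c (\<lambda>t. \<Prod>i\<in>A. f i t)"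
  by (induction A rule: infinite_finite_induct) (auto intro: entire_up_to_mult entire_up_to_const)

lemmas entire_up_to_intros = entire_up_to_mult entire_up_to_add entire_up_to_divide
  entire_up_to_uminus entire_up_to_diff entire_up_to_power entire_up_to_const

lemma entire_up_to_det:
  fixes A :: "real \<Rightarrow> real^'n^'n"
  assumes "\<And>i j. entire_up_to c (\<lambda>t. A t $ i $ j)"
  shows "entire_up_to c (\<lambda>t. det (A t))"
  unfolding det_def
  by (intro entire_up_to_sum entire_up_to_mult entire_up_to_prod entire_up_to_const assms)

text \<open>The identity theorem for the entire extension of \<open>c^n * f\<close>, which vanishes
  on a set accumulating at \<open>\<xi>\<close>; where \<open>c\<close> is nonzero, the power of
  \<open>c\<close> cancels.\<close>

lemma entire_up_to_eq_0:
  assumes f: "entire_up_to c f" and T: "\<xi> islimpt T" "\<And>t. t \<in> T \<Longrightarrow> f t = 0"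
    and cT: "\<And>t. t \<in> T \<Longrightarrow> c t \<noteq> 0" and s: "c s \<noteq> 0"
  shows "f s = 0"
proof -
  obtain n F where F: "F holomorphic_on UNIV" "\<And>t. c t \<noteq> 0 \<Longrightarrow> F (of_real t) = of_real (c t ^ n * f t)"
    using f unfolding entire_up_to_def by blast
  have "complex_of_real \<xi> islimpt of_real ` T"
    unfolding islimpt_approachable
  proof (intro allI impI)
    fix e :: real assume "e > 0"
    then obtain t where t: "t \<in> T" "t \<noteq> \<xi>" "dist t \<xi> < e"
      using T(1) unfolding islimpt_approachable by blast
    have "dist (complex_of_real t) (of_real \<xi>) = dist t \<xi>"
      by (simp add: dist_norm flip: of_real_diff)
    with t show "\<exists>x'\<in>complex_of_real ` T. x' \<noteq> complex_of_real \<xi> \<and> dist x' (complex_of_real \<xi>) < e"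
      by auto
  qed
  then have "F (of_real s) = 0"
    by (rule analytic_continuation[OF F(1) open_UNIV connected_UNIV subset_UNIV UNIV_I])
      (use F(2) T(2) cT in auto)
  with F(2)[OF s] s show ?thesis by simp
qed

section \<open>Polynomials whose coefficients continue analytically\<close>

definition entire_coeffs :: "(real \<Rightarrow> real poly) \<Rightarrow> bool" where
  "entire_coeffs p \<longleftrightarrow> (\<forall>k. entire_up_to c (\<lambda>t. coeff (p t) k))"

lemma entire_coeffs_pCons:
  "entire_up_to c f \<Longrightarrow> entire_coeffs p \<Longrightarrow> entire_coeffs (\<lambda>t. pCons (f t) (p t))"
  unfolding entire_coeffs_def
proof
  fix k assume "entire_up_to c f" "\<forall>k. entire_up_to c (\<lambda>t. coeff (p t) k)"
  then show "entire_up_to c (\<lambda>t. coeff (pCons (f t) (p t)) k)"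
    by (cases k) simp_all
qed

lemma entire_coeffs_0: "entire_coeffs (\<lambda>t. 0)"
  by (simp add: entire_coeffs_def entire_up_to_const)

lemma entire_coeffs_add:
  "entire_coeffs p \<Longrightarrow> entire_coeffs q \<Longrightarrow> entire_coeffs (\<lambda>t. p t + q t)"
  by (simp add: entire_coeffs_def entire_up_to_add)

lemma entire_coeffs_smult:
  "entire_up_to c f \<Longrightarrow> entire_coeffs q \<Longrightarrow> entire_coeffs (\<lambda>t. smult (f t) (q t))"
  by (simp add: entire_coeffs_def entire_up_to_mult)

lemma entire_coeffs_mult:
  "entire_coeffs p \<Longrightarrow> entire_coeffs q \<Longrightarrow> entire_coeffs (\<lambda>t. p t * q t)"
  by (simp add: entire_coeffs_def coeff_mult entire_up_to_sum entire_up_to_mult)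

lemmas entire_coeffs_intros = entire_coeffs_pCons entire_coeffs_0 entire_coeffs_add
  entire_coeffs_smult entire_coeffs_mult

text \<open>The Sylvester determinant is polynomial in the coefficients, hence
  \<open>entire_up_to c\<close>. Common real roots make it vanish on \<open>T\<close>, so it
  vanishes wherever \<open>c\<close> does not. At \<open>s\<close> the common root may be nonreal;
  the nonzero leading coefficient fixes the degree of \<open>p s\<close> at
  \<open>m\<close>.\<close>

theorem common_root_continuation:
  fixes p q :: "real \<Rightarrow> real poly"
  assumes p: "entire_coeffs p" "\<And>t. degree (p t) \<le> m"
    and q: "entire_coeffs q" "\<And>t. degree (q t) \<le> n" and card: "CARD('n::finite) = m + n"
    and T: "\<xi> islimpt T" "\<And>t. t \<in> T \<Longrightarrow> c t \<noteq> 0"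
      "\<And>t. t \<in> T \<Longrightarrow> \<exists>z. poly (p t) z = 0 \<and> poly (q t) z = 0"
    and s: "c s \<noteq> 0" "coeff (p s) m \<noteq> 0"
  obtains z :: complex where "poly (map_poly of_real (p s)) z = 0" "poly (map_poly of_real (q s)) z = 0"
proof -
  obtain h :: "'n \<Rightarrow> nat" where h: "bij_betw h UNIV {..<m + n}"
    using ex_bij_betw_finite_nat[of "UNIV :: 'n set"] card by (auto simp: lessThan_atLeast0)
  have "entire_coeffs (\<lambda>t. shifted_row n (p t) (q t) i)" for i
  proof (cases "i < n")
    case True
    have "entire_coeffs (\<lambda>t. monom 1 i * p t)"
      by (rule entire_coeffs_mult[OF _ p(1)]) (simp add: entire_coeffs_def entire_up_to_const)
    with True show ?thesis by (simp add: shifted_row_def)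
  next
    case False
    have "entire_coeffs (\<lambda>t. monom 1 (i - n) * q t)"
      by (rule entire_coeffs_mult[OF _ q(1)]) (simp add: entire_coeffs_def entire_up_to_const)
    with False show ?thesis by (simp add: shifted_row_def)
  qed
  then have "entire_up_to c (\<lambda>t. det (sylvester h n (p t) (q t)))"
    by (intro entire_up_to_det) (simp add: sylvester_def entire_coeffs_def)
  then have "det (sylvester h n (p s) (q s)) = 0"
    by (rule entire_up_to_eq_0[OF _ T(1) _ T(2) s(1)])
      (use T(3) det_sylvester_common_root[OF h p(2) q(2)] in auto)
  moreover have "degree (p s) = m" "p s \<noteq> 0"
    using p(2)[of s] le_degree[OF s(2)] s(2) by auto
  ultimately show ?thesis
    using common_complex_root_of_det_sylvester[OF h _ _ q(2)] that by blast
qed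

end

subsection \<open>Asymptotics of common roots\<close>

text \<open>Notation along a biharmonic profile, with \<open>D = r d/ds\<close> and twice the mean curvature vector
  written as \<open>(a, b, c)\<close> in the directions \<open>x\<close>, \<open>y\<close> and radial: \<open>k = D c / c\<close>,
  \<open>e = (a^2 + b^2) / c^2\<close>, and \<open>e'\<close>, \<open>e''\<close> are the first two \<open>D\<close>-derivatives of \<open>a^2 + b^2\<close>,
  divided by \<open>c^2\<close>. Hence \<open>D k = 1 - k^2\<close>, \<open>D e = e' - 2 k e\<close>, \<open>D e' = e'' - 2 k e'\<close>,
  \<open>D e'' = - 2 k e''\<close>. The quartic is the equation satisfied by \<open>q = r c\<close>.\<close>

definition coef1 :: "real \<Rightarrow> real \<Rightarrow> real \<Rightarrow> real \<Rightarrow> real" where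
  "coef1 k e e' e'' = 15/2 * (1 - k^2) + 4 * e + (1 - k^2) * e - 4 * k * e' + 3/4 * e''"

definition coef2 :: "real \<Rightarrow> real \<Rightarrow> real \<Rightarrow> real \<Rightarrow> real" where
  "coef2 k e e' e'' = 4 * (1 + e)^2 + 3 * (1 + e) - 15/8 * (2*k + e')^2
     - 5/2 * (1 + e) * k * (2*k + e') + 3/2 * (1 + e) * (2*k^2 + 2 + e'')"

definition coef3 :: "real \<Rightarrow> real \<Rightarrow> real \<Rightarrow> real \<Rightarrow> real" where
  "coef3 k e e' e'' = (1 + e)^3 + 3 * (1 + e)^2 - 21/16 * (1 + e) * (2*k + e')^2
     + 3/4 * (1 + e)^2 * (2*k^2 + 2 + e'')"

definition coef4 :: "real \<Rightarrow> real" where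
  "coef4 e = (1 + e)^3"

definition quartic :: "real \<Rightarrow> real \<Rightarrow> real \<Rightarrow> real \<Rightarrow> real poly" where
  "quartic k e e' e'' = [:2 * (1 - k^2), coef1 k e e' e'', coef2 k e e' e'', coef3 k e e' e'', coef4 e:]"

definition cubic :: "real \<Rightarrow> real \<Rightarrow> real \<Rightarrow> real \<Rightarrow> real poly" where
  "cubic k e e' e'' = [:coef1 k e e' e'', coef2 k e e' e'', coef3 k e e' e'', coef4 e:]"

text \<open>The \<open>dcoef\<close> are the \<open>D\<close>-derivatives of the \<open>coef\<close>, and
  \<open>D q = q^2 slope / (1 + (1 + e) q)\<close>. Writing \<open>P\<close> for the value of the quartic at \<open>q\<close>, the combination
  \<open>(1 + (1 + e) q) (D P + 2 k P)\<close> has no constant term in \<open>q\<close>; \<open>resid\<close> is its quotient by \<open>q\<close>.\<close>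

definition dcoef2 :: "real \<Rightarrow> real \<Rightarrow> real \<Rightarrow> real \<Rightarrow> real" where
  "dcoef2 k e e' e'' = (8 * (1 + e) + 3) * (e' - 2*k*e)
     - 15/4 * (2*k + e') * (2 * (1 - k^2) + e'' - 2*k*e')
     - 5/2 * ((e' - 2*k*e) * k * (2*k + e') + (1 + e) * (1 - k^2) * (2*k + e')
        + (1 + e) * k * (2 * (1 - k^2) + e'' - 2*k*e'))
     + 3/2 * ((e' - 2*k*e) * (2*k^2 + 2 + e'') + (1 + e) * (4*k*(1 - k^2) - 2*k*e''))"

definition dcoef3 :: "real \<Rightarrow> real \<Rightarrow> real \<Rightarrow> real \<Rightarrow> real" where
  "dcoef3 k e e' e'' = (3 * (1 + e)^2 + 6 * (1 + e)) * (e' - 2*k*e)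
     - 21/16 * ((e' - 2*k*e) * (2*k + e')^2
        + 2 * (1 + e) * (2*k + e') * (2 * (1 - k^2) + e'' - 2*k*e'))
     + 3/4 * (2 * (1 + e) * (e' - 2*k*e) * (2*k^2 + 2 + e'')
        + (1 + e)^2 * (4*k*(1 - k^2) - 2*k*e''))"

definition dcoef4 :: "real \<Rightarrow> real \<Rightarrow> real \<Rightarrow> real" where
  "dcoef4 k e e' = 3 * (1 + e)^2 * (e' - 2*k*e)"

definition slope :: "real \<Rightarrow> real \<Rightarrow> real \<Rightarrow> real" where
  "slope k e e' = - (1/2) * k + k*e - 3/4 * e'"

definition resid0 :: "real \<Rightarrow> real \<Rightarrow> real \<Rightarrow> real \<Rightarrow> real" where
  "resid0 k e e' e'' = 4 * e' - 2*k*(1 - k^2)*e - 3 * (1 - k^2) * e' - 4*k*e''"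

definition resid1 :: "real \<Rightarrow> real \<Rightarrow> real \<Rightarrow> real \<Rightarrow> real" where
  "resid1 k e e' e'' = resid0 k e e' e'' * (1 + e) + coef1 k e e' e'' * slope k e e'
     + dcoef2 k e e' e'' + 2 * k * coef2 k e e' e''"

definition resid2 :: "real \<Rightarrow> real \<Rightarrow> real \<Rightarrow> real \<Rightarrow> real" where
  "resid2 k e e' e'' = dcoef2 k e e' e'' * (1 + e) + dcoef3 k e e' e''
     + 2 * coef2 k e e' e'' * slope k e e'
     + 2 * k * (coef3 k e e' e'' + coef2 k e e' e'' * (1 + e))"

definition resid3 :: "real \<Rightarrow> real \<Rightarrow> real \<Rightarrow> real \<Rightarrow> real" where
  "resid3 k e e' e'' = dcoef3 k e e' e'' * (1 + e) + dcoef4 k e e'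
     + 3 * coef3 k e e' e'' * slope k e e'
     + 2 * k * (coef4 e + coef3 k e e' e'' * (1 + e))"

definition resid4 :: "real \<Rightarrow> real \<Rightarrow> real \<Rightarrow> real \<Rightarrow> real" where
  "resid4 k e e' e'' = dcoef4 k e e' * (1 + e) + 4 * coef4 e * slope k e e' + 2 * k * coef4 e * (1 + e)"

definition resid :: "real \<Rightarrow> real \<Rightarrow> real \<Rightarrow> real \<Rightarrow> real poly" where
  "resid k e e' e'' = [:resid0 k e e' e'', resid1 k e e' e'', resid2 k e e' e'', resid3 k e e' e'', resid4 k e e' e'':]"

lemmas coef_defs = coef1_def coef2_def coef3_def coef4_def dcoef2_def dcoef3_def dcoef4_def
  slope_def resid0_def resid1_def resid2_def resid3_def resid4_def

text \<open>Cauchy's root bound: for \<open>norm z > 8\<close> the lower terms contribute at most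
  \<open>4 * norm z ^ 3\<close>, less than the leading term, which is at least
  \<open>norm z ^ 4 / 2\<close>.\<close>

lemma quartic_root_bound:
  fixes z :: complex
  assumes z: "a0 + z * (a1 + z * (a2 + z * (a3 + z * a4))) = 0"
    and a4: "norm a4 \<ge> 1/2" and a: "norm a0 + norm a1 + norm a2 + norm a3 \<le> 4"
  shows "norm z \<le> 8"
proof (rule ccontr)
  assume "\<not> norm z \<le> 8"
  then have z8: "norm z > 8" by simp
  have le: "norm z ^ i \<le> norm z ^ 3" if "i \<le> 3" for i
    by (rule power_increasing) (use that z8 in auto)
  have "a4 * z^4 = - (a0 + a1 * z + a2 * z^2 + a3 * z^3)"
    using z by (simp add: algebra_simps power2_eq_square power3_eq_cube power4_eq_xxxx eq_neg_iff_add_eq_0)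
  then have "norm a4 * norm z ^ 4 = norm (a0 + a1 * z + a2 * z^2 + a3 * z^3)"
    by (metis norm_minus_cancel norm_mult norm_power)
  also have "\<dots> \<le> norm a0 + norm a1 * norm z ^ 1 + norm a2 * norm z ^ 2 + norm a3 * norm z ^ 3"
    by (auto intro!: norm_triangle_le add_mono simp: norm_mult norm_power)
  also have "\<dots> \<le> norm a0 * norm z ^ 3 + norm a1 * norm z ^ 3 + norm a2 * norm z ^ 3 + norm a3 * norm z ^ 3"
    using le[of 0] le[of 1] le[of 2]
    by (intro add_mono mult_left_mono) (auto simp: mult_le_cancel_left1 not_less)
  also have "\<dots> = (norm a0 + norm a1 + norm a2 + norm a3) * norm z ^ 3"
    by (simp add: algebra_simps)
  also have "\<dots> \<le> 4 * norm z ^ 3"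
    by (rule mult_right_mono[OF a]) simp
  finally have "norm a4 * norm z * norm z ^ 3 \<le> 4 * norm z ^ 3"
    by (simp add: power4_eq_xxxx power3_eq_cube mult.assoc)
  then have "norm a4 * norm z \<le> 4"
    using z8 by (auto simp: mult_le_cancel_right)
  moreover have "(1/2) * norm z \<le> norm a4 * norm z"
    using a4 by (rule mult_right_mono) simp
  ultimately show False using z8 by linarith
qed

text \<open>The Bezout identity for the limits \<open>z^2 (1/2 + 7/4 z + z^2)\<close> and \<open>z (1 + 4 z + 23/8 z^2)\<close>
  of the two polynomials, whose greatest common divisor is \<open>z\<close>.\<close>
lemma limit_bezout:
  fixes z :: "'a::field_char_0"
  shows "(- (2177/17) - 8441/68 * z) * (z^2 * (1/2 + 7/4 * z + z^2))
     + (1 + 2041/34 * z + 734/17 * z^2) * (z * (1 + 4 * z + 23/8 * z^2)) = z"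
  by (simp add: field_simps power2_eq_square)

text \<open>The regime of a growing mode for large \<open>t\<close>: \<open>c\<close> dominates the
  affine functions \<open>a\<close> and \<open>b\<close>, and \<open>k = D c / c\<close> tends to 1.
  The root \<open>z\<close> is an arbitrary selection, not assumed continuous.\<close>

locale asymptotic =
  fixes k e e' e'' :: "real \<Rightarrow> real" and z :: "real \<Rightarrow> complex"
  assumes k: "(k \<longlongrightarrow> 1) at_top" and e: "(e \<longlongrightarrow> 0) at_top"
    and e': "(e' \<longlongrightarrow> 0) at_top" and e'': "(e'' \<longlongrightarrow> 0) at_top"
    and quartic_root: "eventually (\<lambda>t. poly (map_poly of_real (quartic (k t) (e t) (e' t) (e'' t))) (z t) = 0) at_top"
    and resid_root: "eventually (\<lambda>t. poly (map_poly of_real (resid (k t) (e t) (e' t) (e'' t))) (z t) = 0) at_top"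
begin

lemma
  shows lim_coef1: "((\<lambda>t. coef1 (k t) (e t) (e' t) (e'' t)) \<longlongrightarrow> 0) at_top"
    and lim_coef2: "((\<lambda>t. coef2 (k t) (e t) (e' t) (e'' t)) \<longlongrightarrow> 1/2) at_top"
    and lim_coef3: "((\<lambda>t. coef3 (k t) (e t) (e' t) (e'' t)) \<longlongrightarrow> 7/4) at_top"
    and lim_coef4: "((\<lambda>t. coef4 (e t)) \<longlongrightarrow> 1) at_top"
    and lim_dcoef2: "((\<lambda>t. dcoef2 (k t) (e t) (e' t) (e'' t)) \<longlongrightarrow> 0) at_top"
    and lim_dcoef3: "((\<lambda>t. dcoef3 (k t) (e t) (e' t) (e'' t)) \<longlongrightarrow> 0) at_top"
    and lim_dcoef4: "((\<lambda>t. dcoef4 (k t) (e t) (e' t)) \<longlongrightarrow> 0) at_top"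
    and lim_slope: "((\<lambda>t. slope (k t) (e t) (e' t)) \<longlongrightarrow> -1/2) at_top"
    and lim_resid0: "((\<lambda>t. resid0 (k t) (e t) (e' t) (e'' t)) \<longlongrightarrow> 0) at_top"
  unfolding coef1_def coef2_def coef3_def coef4_def dcoef2_def dcoef3_def dcoef4_def
    slope_def resid0_def
  by (rule tendsto_eq_intros refl k e e' e'' | simp)+

lemma
  shows lim_resid1: "((\<lambda>t. resid1 (k t) (e t) (e' t) (e'' t)) \<longlongrightarrow> 1) at_top"
    and lim_resid2: "((\<lambda>t. resid2 (k t) (e t) (e' t) (e'' t)) \<longlongrightarrow> 4) at_top"
    and lim_resid3: "((\<lambda>t. resid3 (k t) (e t) (e' t) (e'' t)) \<longlongrightarrow> 23/8) at_top"
    and lim_resid4: "((\<lambda>t. resid4 (k t) (e t) (e' t) (e'' t)) \<longlongrightarrow> 0) at_top"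
  unfolding resid1_def resid2_def resid3_def resid4_def
  by (rule tendsto_eq_intros refl k e lim_coef1 lim_coef2 lim_coef3 lim_coef4 lim_dcoef2
      lim_dcoef3 lim_dcoef4 lim_slope lim_resid0 | simp)+

lemma lim_c0: "((\<lambda>t. 2 * (1 - (k t)^2)) \<longlongrightarrow> 0) at_top"
  by (rule tendsto_eq_intros refl k | simp)+

text \<open>The roots stay bounded, so replacing the coefficients by their limits changes both
  equations by errors tending to 0. The identity \<open>limit_bezout\<close> then expresses
  \<open>z\<close> through these errors.\<close>

lemma root_tendsto_0: "(z \<longlongrightarrow> 0) at_top"
proof -
  define a0 a1 a2 a3 a4 r0 r1 r2 r3 r4 where a:
    "a0 = (\<lambda>t. complex_of_real (2 * (1 - (k t)^2)))"
    "a1 = (\<lambda>t. complex_of_real (coef1 (k t) (e t) (e' t) (e'' t)))"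
    "a2 = (\<lambda>t. complex_of_real (coef2 (k t) (e t) (e' t) (e'' t)))"
    "a3 = (\<lambda>t. complex_of_real (coef3 (k t) (e t) (e' t) (e'' t)))"
    "a4 = (\<lambda>t. complex_of_real (coef4 (e t)))"
    "r0 = (\<lambda>t. complex_of_real (resid0 (k t) (e t) (e' t) (e'' t)))"
    "r1 = (\<lambda>t. complex_of_real (resid1 (k t) (e t) (e' t) (e'' t)))"
    "r2 = (\<lambda>t. complex_of_real (resid2 (k t) (e t) (e' t) (e'' t)))"
    "r3 = (\<lambda>t. complex_of_real (resid3 (k t) (e t) (e' t) (e'' t)))"
    "r4 = (\<lambda>t. complex_of_real (resid4 (k t) (e t) (e' t) (e'' t)))"
  note lims = lim_c0 lim_coef1 lim_coef2 lim_coef3 lim_coef4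
    lim_resid0 lim_resid1 lim_resid2 lim_resid3 lim_resid4
  note lim = lims[THEN tendsto_of_real[where 'a = complex], folded a, simplified]
  have P: "eventually (\<lambda>t. a0 t + z t * (a1 t + z t * (a2 t + z t * (a3 t + z t * a4 t))) = 0) at_top"
    using quartic_root by (simp add: quartic_def map_poly_pCons a)
  have R: "eventually (\<lambda>t. r0 t + z t * (r1 t + z t * (r2 t + z t * (r3 t + z t * r4 t))) = 0) at_top"
    using resid_root by (simp add: resid_def map_poly_pCons a)
  have "((\<lambda>t. norm (a0 t) + norm (a1 t) + norm (a2 t) + norm (a3 t)) \<longlongrightarrow> 9/4) at_top"
    by (rule tendsto_eq_intros refl lim | simp)+
  then have "eventually (\<lambda>t. norm (a0 t) + norm (a1 t) + norm (a2 t) + norm (a3 t) < 4) at_top"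
    by (rule order_tendstoD) simp
  moreover have "((\<lambda>t. norm (a4 t)) \<longlongrightarrow> 1) at_top"
    by (rule tendsto_eq_intros refl lim | simp)+
  then have "eventually (\<lambda>t. norm (a4 t) > 1/2) at_top"
    by (rule order_tendstoD) simp
  ultimately have bound: "eventually (\<lambda>t. norm (z t) \<le> 8) at_top"
    using P by eventually_elim (rule quartic_root_bound, auto)
  have small: "((\<lambda>t. x t * z t ^ n) \<longlongrightarrow> 0) at_top" if "(x \<longlongrightarrow> 0) at_top" for x :: "real \<Rightarrow> complex" and n
  proof (rule Lim_null_comparison)
    show "eventually (\<lambda>t. norm (x t * z t ^ n) \<le> norm (x t) * 8 ^ n) at_top"
      using bound by eventually_elim (auto simp: norm_mult norm_power intro!: mult_left_mono power_mono)
    show "((\<lambda>t. norm (x t) * 8 ^ n) \<longlongrightarrow> 0) at_top"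
      by (rule tendsto_eq_intros refl that | simp)+
  qed
  have d: "((\<lambda>t. x t - l) \<longlongrightarrow> 0) at_top" if "(x \<longlongrightarrow> l) at_top" for x :: "real \<Rightarrow> complex" and l
    using that LIM_zero by blast
  have P1: "((\<lambda>t. - (a0 t * z t ^ 0 + a1 t * z t ^ 1 + (a2 t - 1/2) * z t ^ 2 + (a3 t - 7/4) * z t ^ 3
      + (a4 t - 1) * z t ^ 4)) \<longlongrightarrow> - (0 + 0 + 0 + 0 + 0)) at_top"
    by (intro tendsto_minus tendsto_add small d lim)
  have P0: "((\<lambda>t. (z t)^2 * (1/2 + 7/4 * z t + (z t)^2)) \<longlongrightarrow> 0) at_top"
    by (rule Lim_transform_eventually[OF P1[unfolded add_0_left minus_zero]])
      (use P in \<open>eventually_elim, simp add: algebra_simps power2_eq_square power3_eq_cube power4_eq_xxxx\<close>)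
  have R1: "((\<lambda>t. - (r0 t * z t ^ 0 + (r1 t - 1) * z t ^ 1 + (r2 t - 4) * z t ^ 2 + (r3 t - 23/8) * z t ^ 3
      + r4 t * z t ^ 4)) \<longlongrightarrow> - (0 + 0 + 0 + 0 + 0)) at_top"
    by (intro tendsto_minus tendsto_add small d lim)
  have R0: "((\<lambda>t. z t * (1 + 4 * z t + 23/8 * (z t)^2)) \<longlongrightarrow> 0) at_top"
    by (rule Lim_transform_eventually[OF R1[unfolded add_0_left minus_zero]])
      (use R in \<open>eventually_elim, simp add: algebra_simps power2_eq_square power3_eq_cube power4_eq_xxxx\<close>)
  define Z Y where "Z t = (z t)^2 * (1/2 + 7/4 * z t + (z t)^2)"
    and "Y t = z t * (1 + 4 * z t + 23/8 * (z t)^2)" for t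
  have ZY: "(Z \<longlongrightarrow> 0) at_top" "(Y \<longlongrightarrow> 0) at_top"
    using P0 R0 by (simp_all add: Z_def[abs_def] Y_def[abs_def])
  have "((\<lambda>t. (- (2177/17) * Z t) * z t ^ 0 + (- 8441/68 * Z t) * z t ^ 1
     + Y t * z t ^ 0 + (2041/34 * Y t) * z t ^ 1 + (734/17 * Y t) * z t ^ 2) \<longlongrightarrow> 0 + 0 + 0 + 0 + 0) at_top"
    by (intro tendsto_add small tendsto_mult_right_zero ZY)
  moreover have "(- (2177/17) * Z t) * z t ^ 0 + (- 8441/68 * Z t) * z t ^ 1
     + Y t * z t ^ 0 + (2041/34 * Y t) * z t ^ 1 + (734/17 * Y t) * z t ^ 2 = z t" for t
    using limit_bezout[of "z t"] unfolding Z_def[symmetric] Y_def[symmetric]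
    by (simp add: algebra_simps)
  ultimately show ?thesis by simp
qed

text \<open>The linear coefficient of \<open>resid\<close> tends to 1, so a root tending to 0 decays
  like \<open>- resid0\<close>.\<close>

lemma root_eq:
  obtains b where "(b \<longlongrightarrow> 1) at_top"
    "eventually (\<lambda>t. z t * b t = - of_real (resid0 (k t) (e t) (e' t) (e'' t))) at_top"
proof
  let ?b = "\<lambda>t. of_real (resid1 (k t) (e t) (e' t) (e'' t)) + z t * (of_real (resid2 (k t) (e t) (e' t) (e'' t))
    + z t * (of_real (resid3 (k t) (e t) (e' t) (e'' t)) + z t * of_real (resid4 (k t) (e t) (e' t) (e'' t))))"
  show "(?b \<longlongrightarrow> 1) at_top"
    by (rule tendsto_eq_intros refl root_tendsto_0 lim_resid1 lim_resid2 lim_resid3 lim_resid4 | simp)+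
  show "eventually (\<lambda>t. z t * ?b t = - of_real (resid0 (k t) (e t) (e' t) (e'' t))) at_top"
    using resid_root
    by eventually_elim (simp add: resid_def map_poly_pCons eq_neg_iff_add_eq_0 add.commute)
qed

text \<open>The cofactor of \<open>z^2\<close> in the quartic evaluated at \<open>z\<close>.\<close>

definition tail :: "real \<Rightarrow> complex" where
  "tail t = of_real (coef2 (k t) (e t) (e' t) (e'' t)) + z t * (of_real (coef3 (k t) (e t) (e' t) (e'' t))
    + z t * of_real (coef4 (e t)))"

lemma lim_tail: "(tail \<longlongrightarrow> 1/2) at_top"
  unfolding tail_def
  by (rule tendsto_eq_intros refl root_tendsto_0 lim_coef2 lim_coef3 lim_coef4 | simp)+

text \<open>Multiplied by \<open>c^2\<close>, the quartic equation becomes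
  \<open>2 * K + (coef1 * c) * (z * c) + (z * c)^2 * tail = 0\<close>. The rate of decay makes
  \<open>z * c\<close> tend to 0, so only \<open>2 * K\<close> survives in the limit. In the
  application \<open>K\<close> is \<open>4 * C * C'\<close>.\<close>

lemma scaled_discriminant_eq_0:
  assumes ec: "((\<lambda>t. e t * c t) \<longlongrightarrow> 0) at_top" and e'c: "((\<lambda>t. e' t * c t) \<longlongrightarrow> 0) at_top"
    and e''c: "((\<lambda>t. e'' t * c t) \<longlongrightarrow> 0) at_top"
    and kc: "((\<lambda>t. (1 - (k t)^2) * c t) \<longlongrightarrow> 0) at_top"
    and K: "eventually (\<lambda>t. (1 - (k t)^2) * (c t)^2 = K) at_top"
  shows "K = 0"
proof -
  obtain b where b: "(b \<longlongrightarrow> 1) at_top"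
    "eventually (\<lambda>t. z t * b t = - of_real (resid0 (k t) (e t) (e' t) (e'' t))) at_top"
    by (rule root_eq)
  have "((\<lambda>t. 4 * (e' t * c t) - 2 * k t * (1 - (k t)^2) * (e t * c t)
      - 3 * (1 - (k t)^2) * (e' t * c t) - 4 * k t * (e'' t * c t)) \<longlongrightarrow> 0) at_top"
    by (rule tendsto_eq_intros refl k ec e'c e''c | simp)+
  then have "((\<lambda>t. resid0 (k t) (e t) (e' t) (e'' t) * c t) \<longlongrightarrow> 0) at_top"
    by (simp add: resid0_def algebra_simps)
  then have h: "((\<lambda>t. - of_real (resid0 (k t) (e t) (e' t) (e'' t) * c t) / b t) \<longlongrightarrow> - of_real 0 / 1) at_top"
    by (intro tendsto_intros b) simp_all
  have zc: "((\<lambda>t. z t * of_real (c t)) \<longlongrightarrow> 0) at_top"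
  proof (rule Lim_transform_eventually[OF h[unfolded of_real_0 minus_zero div_by_1]])
    have "eventually (\<lambda>t. b t \<noteq> 0) at_top"
      using b(1) by (rule tendsto_imp_eventually_ne) simp
    then show "eventually (\<lambda>t. - of_real (resid0 (k t) (e t) (e' t) (e'' t) * c t) / b t = z t * of_real (c t)) at_top"
      using b(2)
    proof eventually_elim
      case (elim t)
      then have "z t = - of_real (resid0 (k t) (e t) (e' t) (e'' t)) / b t"
        by (intro eq_divide_imp)
      then show ?case by simp
    qed
  qed
  have "((\<lambda>t. 15/2 * ((1 - (k t)^2) * c t) + 4 * (e t * c t) + (1 - (k t)^2) * (e t * c t)
     - 4 * k t * (e' t * c t) + 3/4 * (e'' t * c t)) \<longlongrightarrow> 0) at_top"
    by (rule tendsto_eq_intros refl k ec e'c e''c kc | simp)+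
  moreover have "15/2 * ((1 - (k t)^2) * c t) + 4 * (e t * c t) + (1 - (k t)^2) * (e t * c t)
     - 4 * k t * (e' t * c t) + 3/4 * (e'' t * c t) = coef1 (k t) (e t) (e' t) (e'' t) * c t" for t
    unfolding coef1_def by algebra
  ultimately have c1: "((\<lambda>t. coef1 (k t) (e t) (e' t) (e'' t) * c t) \<longlongrightarrow> 0) at_top"
    by (simp only:)
  have h1: "((\<lambda>t. of_real (2 * K) + of_real (coef1 (k t) (e t) (e' t) (e'' t) * c t) * (z t * of_real (c t))
     + (z t * of_real (c t))^2 * tail t) \<longlongrightarrow> of_real (2 * K)) at_top"
    by (rule tendsto_eq_intros refl c1 zc lim_tail | simp)+
  have h2: "eventually (\<lambda>t. of_real (2 * K) + of_real (coef1 (k t) (e t) (e' t) (e'' t) * c t) * (z t * of_real (c t))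
     + (z t * of_real (c t))^2 * tail t = 0) at_top"
    using quartic_root K
  proof eventually_elim
    case (elim t)
    have "of_real (c t)^2 * poly (map_poly of_real (quartic (k t) (e t) (e' t) (e'' t))) (z t) = (0::complex)"
      using elim by simp
    then show ?case
      unfolding elim(2)[symmetric]
      by (simp add: quartic_def map_poly_pCons tail_def algebra_simps power2_eq_square)
  qed
  have "complex_of_real (2 * K) = 0"
    by (rule tendsto_unique[OF trivial_limit_at_top_linorder h1 tendsto_eventually[OF h2]])
  then show ?thesis by simp
qed

text \<open>Here the quartic is the cubic times its variable. Eliminating \<open>z\<close> between
  \<open>coef1 + z * tail = 0\<close> and \<open>z * b = - resid0\<close>, then multiplying by
  \<open>c^2\<close>, relates the quadratic \<open>?w\<close> to its derivative \<open>?w'\<close>;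
  their orders of growth cannot balance unless \<open>?w\<close> is 0.\<close>

lemma quadratic_eq_0:
  assumes k1: "\<And>t. k t = 1" and c: "eventually (\<lambda>t. c t \<noteq> 0) at_top"
    and w: "\<And>t. e t = (\<alpha> * t^2 + \<beta> * t + \<gamma>) / (c t)^2" "\<And>t. e' t = (2 * \<alpha> * t + \<beta>) / (c t)^2"
      "\<And>t. e'' t = 2 * \<alpha> / (c t)^2"
    and cubic_root: "eventually (\<lambda>t. poly (map_poly of_real (cubic (k t) (e t) (e' t) (e'' t))) (z t) = 0) at_top"
  shows "\<alpha> = 0 \<and> \<beta> = 0 \<and> \<gamma> = 0"
proof -
  obtain b where b: "(b \<longlongrightarrow> 1) at_top"
    "eventually (\<lambda>t. z t * b t = - of_real (resid0 (k t) (e t) (e' t) (e'' t))) at_top"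
    by (rule root_eq)
  let ?w = "\<lambda>t. \<alpha> * t^2 + \<beta> * t + \<gamma>" and ?w' = "\<lambda>t. 2 * \<alpha> * t + \<beta>"
  have eq: "eventually (\<lambda>t. of_real (4 * ?w t - 4 * ?w' t + 3/2 * \<alpha>) * b t
     = of_real (4 * ?w' t - 8 * \<alpha>) * tail t) at_top"
    using b(2) cubic_root c
  proof eventually_elim
    case (elim t)
    have "of_real (coef1 (k t) (e t) (e' t) (e'' t)) + z t * tail t = 0"
      using elim(2) by (simp add: cubic_def map_poly_pCons tail_def)
    then have "of_real (coef1 (k t) (e t) (e' t) (e'' t)) * b t = - (z t * b t) * tail t"
      by (simp add: eq_neg_iff_add_eq_0 algebra_simps) (metis distrib_left mult.left_commute mult_zero_right)
    also have "\<dots> = of_real (resid0 (k t) (e t) (e' t) (e'' t)) * tail t"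
      using elim(1) by simp
    finally have "of_real ((c t)^2 * coef1 (k t) (e t) (e' t) (e'' t)) * b t
        = of_real ((c t)^2 * resid0 (k t) (e t) (e' t) (e'' t)) * tail t"
      by simp
    moreover have "(c t)^2 * coef1 (k t) (e t) (e' t) (e'' t) = 4 * ?w t - 4 * ?w' t + 3/2 * \<alpha>"
      using elim(3) by (simp add: coef1_def k1 w field_simps)
    moreover have "(c t)^2 * resid0 (k t) (e t) (e' t) (e'' t) = 4 * ?w' t - 8 * \<alpha>"
      using elim(3) by (simp add: resid0_def k1 w field_simps)
    ultimately show ?case by simp
  qed
  \<comment> \<open>Since \<open>b\<close> tends to 1 and \<open>tail\<close> to 1/2, dividing by
    \<open>t^n\<close> isolates a single coefficient of \<open>?w\<close>. The values
    \<open>n = 2\<close>, \<open>1\<close>, \<open>0\<close> yield \<open>\<alpha>\<close>,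
    \<open>\<beta>\<close>, \<open>\<gamma>\<close> in turn.\<close>
  have limit: "L = 0"
    if "((\<lambda>t. (4 * ?w t - 4 * ?w' t + 3/2 * \<alpha>) / t^n) \<longlongrightarrow> L) at_top"
       "((\<lambda>t. (4 * ?w' t - 8 * \<alpha>) / t^n) \<longlongrightarrow> 0) at_top" for L n
  proof -
    have h1: "((\<lambda>t. of_real ((4 * ?w t - 4 * ?w' t + 3/2 * \<alpha>) / t^n) * b t
       - of_real ((4 * ?w' t - 8 * \<alpha>) / t^n) * tail t) \<longlongrightarrow> of_real L * 1 - of_real 0 * (1/2)) at_top"
      by (intro tendsto_intros that b lim_tail)
    have h2: "eventually (\<lambda>t. of_real ((4 * ?w t - 4 * ?w' t + 3/2 * \<alpha>) / t^n) * b t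
       - of_real ((4 * ?w' t - 8 * \<alpha>) / t^n) * tail t = 0) at_top"
      using eq by eventually_elim (simp add: divide_simps)
    have "of_real L * 1 - complex_of_real 0 * (1/2) = 0"
      by (rule tendsto_unique[OF trivial_limit_at_top_linorder h1 tendsto_eventually[OF h2]])
    then show ?thesis by simp
  qed
  have "4 * \<alpha> = 0"
    by (rule limit[of 2]) real_asymp+
  then have \<alpha>: "\<alpha> = 0" by simp
  have "4 * \<beta> = 0"
    by (rule limit[of 1]) (simp add: \<alpha>, real_asymp)+
  then have \<beta>: "\<beta> = 0" by simp
  have "4 * \<gamma> = 0"
    by (rule limit[of 0]) (simp_all add: \<alpha> \<beta>)
  with \<alpha> \<beta> show ?thesis by simp
qed

end

section \<open>Exclusion of nonzero exponential modes\<close>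

definition mode :: "real \<Rightarrow> real \<Rightarrow> real \<Rightarrow> real" where
  "mode C C' t = C * exp t + C' * exp (- t)"

text \<open>As \<open>mode C (- C')\<close> is the derivative of \<open>mode C C'\<close>, the first
  argument is \<open>k = D c / c\<close>; the others are \<open>e\<close>, \<open>e'\<close>,
  \<open>e''\<close> for \<open>a^2 + b^2\<close> written as a quadratic in
  \<open>t\<close>.\<close>

definition quartic_at :: "real \<Rightarrow> real \<Rightarrow> real \<Rightarrow> real \<Rightarrow> real \<Rightarrow> real \<Rightarrow> real poly" where
  "quartic_at C C' \<alpha> \<beta> \<gamma> t = quartic (mode C (- C') t / mode C C' t)
     ((\<alpha> * t^2 + \<beta> * t + \<gamma>) / (mode C C' t)^2) ((2 * \<alpha> * t + \<beta>) / (mode C C' t)^2) (2 * \<alpha> / (mode C C' t)^2)"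

definition resid_at :: "real \<Rightarrow> real \<Rightarrow> real \<Rightarrow> real \<Rightarrow> real \<Rightarrow> real \<Rightarrow> real poly" where
  "resid_at C C' \<alpha> \<beta> \<gamma> t = resid (mode C (- C') t / mode C C' t)
     ((\<alpha> * t^2 + \<beta> * t + \<gamma>) / (mode C C' t)^2) ((2 * \<alpha> * t + \<beta>) / (mode C C' t)^2) (2 * \<alpha> / (mode C C' t)^2)"

lemma mode_uminus: "mode (- C) (- C') t = - mode C C' t"
  by (simp add: mode_def)

lemma mode_reflect: "mode C C' (- t) = mode C' C t"
  by (simp add: mode_def)

text \<open>Reversing \<open>t\<close> changes the sign of derivatives of odd order, hence of
  \<open>k\<close> and \<open>e'\<close>; each expression is even or odd under this change.\<close>

lemma coef_reflect:
  shows "coef1 (- k) e (- e') e'' = coef1 k e e' e''"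
    and "coef2 (- k) e (- e') e'' = coef2 k e e' e''"
    and "coef3 (- k) e (- e') e'' = coef3 k e e' e''"
    and "dcoef2 (- k) e (- e') e'' = - dcoef2 k e e' e''"
    and "dcoef3 (- k) e (- e') e'' = - dcoef3 k e e' e''"
    and "dcoef4 (- k) e (- e') = - dcoef4 k e e'"
    and "slope (- k) e (- e') = - slope k e e'"
    and "resid0 (- k) e (- e') e'' = - resid0 k e e' e''"
  unfolding coef1_def coef2_def coef3_def dcoef2_def dcoef3_def dcoef4_def slope_def resid0_def
  by algebra+

lemma quartic_reflect: "quartic (- k) e (- e') e'' = quartic k e e' e''"
  by (simp add: quartic_def coef_reflect)

lemma resid_reflect: "resid (- k) e (- e') e'' = - resid k e e' e''"
  by (simp add: resid_def resid1_def resid2_def resid3_def resid4_def coef_reflect)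

lemma quartic_at_uminus: "quartic_at (- C) (- C') \<alpha> \<beta> \<gamma> t = quartic_at C C' \<alpha> \<beta> \<gamma> t"
  using mode_uminus[of C "- C'"] by (simp add: quartic_at_def mode_uminus)

lemma resid_at_uminus: "resid_at (- C) (- C') \<alpha> \<beta> \<gamma> t = resid_at C C' \<alpha> \<beta> \<gamma> t"
  using mode_uminus[of C "- C'"] by (simp add: resid_at_def mode_uminus)

lemma mode_derivative_reflect: "mode C (- C') (- t) = - mode C' (- C) t"
  by (simp add: mode_def)

lemma quartic_at_reflect: "quartic_at C C' \<alpha> \<beta> \<gamma> (- t) = quartic_at C' C \<alpha> (- \<beta>) \<gamma> t"
proof -
  have "(2 * \<alpha> * (- t) + \<beta>) / m = - ((2 * \<alpha> * t + - \<beta>) / m)" for m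
    unfolding minus_divide_left by simp
  then show ?thesis
    unfolding quartic_at_def mode_derivative_reflect
    unfolding mode_reflect
    by (simp only: minus_divide_left[symmetric] quartic_reflect power2_minus mult_minus_right mult_minus_left)
qed

lemma resid_at_reflect: "resid_at C C' \<alpha> \<beta> \<gamma> (- t) = - resid_at C' C \<alpha> (- \<beta>) \<gamma> t"
proof -
  have "(2 * \<alpha> * (- t) + \<beta>) / m = - ((2 * \<alpha> * t + - \<beta>) / m)" for m
    unfolding minus_divide_left by simp
  then show ?thesis
    unfolding resid_at_def mode_derivative_reflect
    unfolding mode_reflect
    by (simp only: minus_divide_left[symmetric] resid_reflect power2_minus mult_minus_right mult_minus_left)
qed

lemma degree_pCons5: "degree [:a, b, c, d, e:] \<le> 4"
  by (rule degree_le) (auto simp: coeff_pCons split: nat.splits)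

lemma degree_pCons4: "degree [:a, b, c, d:] \<le> 3"
  by (rule degree_le) (auto simp: coeff_pCons split: nat.splits)

lemma (in entire_denominator) entire_up_to_divide_power2:
  "entire_up_to c f \<Longrightarrow> entire_up_to c (\<lambda>t. f t / (c t)^2)"
  using entire_up_to_divide[OF entire_up_to_divide, of f] by (simp add: power2_eq_square divide_divide_eq_left)

text \<open>Common real roots on \<open>T\<close> continue to common complex roots for all large
  \<open>t\<close>, where the asymptotics apply. If \<open>C'\<close> is nonzero, the scaled
  discriminant yields the contradiction \<open>4 * C * C' = 0\<close>. If \<open>C' = 0\<close>, the
  cubic factor forces \<open>\<alpha>\<close>, \<open>\<beta>\<close>, \<open>\<gamma>\<close> to
  vanish, and then 0 is the only common root on \<open>T\<close>.\<close>

lemma no_growing_mode_pos: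
  assumes C: "C > 0" and T: "\<xi> islimpt T"
    and cT: "\<And>t. t \<in> T \<Longrightarrow> mode C C' t \<noteq> 0"
    and q: "\<And>t. t \<in> T \<Longrightarrow> q t \<noteq> 0 \<and> poly (quartic_at C C' \<alpha> \<beta> \<gamma> t) (q t) = 0 \<and> poly (resid_at C C' \<alpha> \<beta> \<gamma> t) (q t) = 0"
  shows False
proof -
  define c where "c = mode C C'"
  define k where "k t = mode C (- C') t / c t" for t
  define e where "e t = (\<alpha> * t^2 + \<beta> * t + \<gamma>) / (c t)^2" for t
  define e' where "e' t = (2 * \<alpha> * t + \<beta>) / (c t)^2" for t
  define e'' where "e'' t = 2 * \<alpha> / (c t)^2" for t
  let ?P = "\<lambda>t. quartic (k t) (e t) (e' t) (e'' t)" and ?R = "\<lambda>t. resid (k t) (e t) (e' t) (e'' t)"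
    and ?Q = "\<lambda>t. cubic (k t) (e t) (e' t) (e'' t)"
  have P: "quartic_at C C' \<alpha> \<beta> \<gamma> t = ?P t" and R: "resid_at C C' \<alpha> \<beta> \<gamma> t = ?R t" for t
    by (simp_all add: quartic_at_def resid_at_def k_def e_def e'_def e''_def c_def)
  interpret entire_denominator c "\<lambda>z. of_real C * exp z + of_real C' * exp (- z)"
    by standard (auto intro!: holomorphic_intros simp: c_def mode_def exp_of_real simp flip: of_real_minus)
  have id: "entire_up_to c (\<lambda>t. t)"
    by (rule entire_up_to_holomorphic[of "\<lambda>z. z"]) auto
  have "entire_up_to c (mode C (- C'))"
    by (rule entire_up_to_holomorphic[of "\<lambda>z. of_real C * exp z - of_real C' * exp (- z)"])
      (auto intro!: holomorphic_intros simp: mode_def exp_of_real simp flip: of_real_minus)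
  then have ek: "entire_up_to c k"
    unfolding k_def by (rule entire_up_to_divide)
  have ee: "entire_up_to c e" "entire_up_to c e'" "entire_up_to c e''"
    unfolding e_def e'_def e''_def
    by (intro entire_up_to_divide_power2 entire_up_to_intros id)+
  have eP: "entire_coeffs ?P" and eQ: "entire_coeffs ?Q"
    unfolding quartic_def cubic_def coef_defs
    by (intro entire_coeffs_intros entire_up_to_intros ek ee)+
  have eR: "entire_coeffs ?R"
    unfolding resid_def coef_defs
    by (intro entire_coeffs_intros entire_up_to_intros ek ee)+
  have ct0: "((\<lambda>t. 1 / c t) \<longlongrightarrow> 0) at_top" and ct1: "((\<lambda>t. t / c t) \<longlongrightarrow> 0) at_top"
    and ct2: "((\<lambda>t. t^2 / c t) \<longlongrightarrow> 0) at_top"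
    and k: "(k \<longlongrightarrow> 1) at_top"
    unfolding c_def k_def mode_def using C by real_asymp+
  have c0: "eventually (\<lambda>t. c t \<noteq> 0) at_top"
  proof -
    have "eventually (\<lambda>t. c t > 0) at_top"
      unfolding c_def mode_def using C by real_asymp
    then show ?thesis by eventually_elim simp
  qed
  have "((\<lambda>t. \<alpha> * (t^2 / c t) + \<beta> * (t / c t) + \<gamma> * (1 / c t)) \<longlongrightarrow> 0) at_top"
    by (rule tendsto_eq_intros refl ct0 ct1 ct2 | simp)+
  moreover have "\<alpha> * (t^2 / c t) + \<beta> * (t / c t) + \<gamma> * (1 / c t) = e t * c t" for t
    by (cases "c t = 0") (simp_all add: e_def power2_eq_square field_simps)
  ultimately have ec: "((\<lambda>t. e t * c t) \<longlongrightarrow> 0) at_top"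
    by (simp only:)
  have "((\<lambda>t. 2 * \<alpha> * (t / c t) + \<beta> * (1 / c t)) \<longlongrightarrow> 0) at_top"
    by (rule tendsto_eq_intros refl ct0 ct1 | simp)+
  moreover have "2 * \<alpha> * (t / c t) + \<beta> * (1 / c t) = e' t * c t" for t
    by (cases "c t = 0") (simp_all add: e'_def power2_eq_square field_simps)
  ultimately have e'c: "((\<lambda>t. e' t * c t) \<longlongrightarrow> 0) at_top"
    by (simp only:)
  have "((\<lambda>t. 2 * \<alpha> * (1 / c t)) \<longlongrightarrow> 0) at_top"
    by (rule tendsto_eq_intros refl ct0 | simp)+
  moreover have "2 * \<alpha> * (1 / c t) = e'' t * c t" for t
    by (cases "c t = 0") (simp_all add: e''_def power2_eq_square)
  ultimately have e''c: "((\<lambda>t. e'' t * c t) \<longlongrightarrow> 0) at_top"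
    by (simp only:)
  have over_c: "(f \<longlongrightarrow> 0) at_top" if "((\<lambda>t. f t * c t) \<longlongrightarrow> 0) at_top" for f :: "real \<Rightarrow> real"
  proof (rule Lim_transform_eventually)
    show "((\<lambda>t. (f t * c t) * (1 / c t)) \<longlongrightarrow> 0) at_top"
      by (rule tendsto_eq_intros refl that ct0 | simp)+
    show "eventually (\<lambda>t. (f t * c t) * (1 / c t) = f t) at_top"
      using c0 by eventually_elim simp
  qed
  have e: "(e \<longlongrightarrow> 0) at_top" and e': "(e' \<longlongrightarrow> 0) at_top" and e'': "(e'' \<longlongrightarrow> 0) at_top"
    by (fact over_c[OF ec] over_c[OF e'c] over_c[OF e''c])+
  have "((\<lambda>t. coef4 (e t)) \<longlongrightarrow> 1) at_top"
    unfolding coef4_def by (rule tendsto_eq_intros refl e | simp)+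
  then have lead: "eventually (\<lambda>t. coef4 (e t) \<noteq> 0) at_top"
    by (rule tendsto_imp_eventually_ne) simp
  \<comment> \<open>\<open>c^2 - (D c)^2\<close> is a first integral of
    \<open>D^2 c = c\<close>.\<close>
  have disc: "(1 - (k t)^2) * (c t)^2 = 4 * C * C'" if "c t \<noteq> 0" for t
  proof -
    have "(1 - (k t)^2) * (c t)^2 = (mode C C' t)^2 - (mode C (- C') t)^2"
      using that by (simp add: k_def c_def field_simps)
    also have "\<dots> = 4 * C * C' * (exp t * exp (- t))"
      by (simp add: mode_def power2_eq_square algebra_simps)
    finally show ?thesis by (simp flip: exp_add)
  qed
  show False
  proof (cases "C' = 0")
    case False
    have "\<exists>z::complex. poly (map_poly of_real (?P t)) z = 0 \<and> poly (map_poly of_real (?R t)) z = 0"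
      if "c t \<noteq> 0" "coef4 (e t) \<noteq> 0" for t
    proof -
      have lead: "coeff (?P t) 4 \<noteq> 0"
        using that by (simp add: quartic_def eval_nat_numeral)
      have deg: "degree (?P u) \<le> 4" "degree (?R u) \<le> 4" for u
        by (simp_all only: quartic_def resid_def degree_pCons5)
      \<comment> \<open>The numeral type indexes the Sylvester matrix of two polynomials of degree
        at most 4.\<close>
      have card: "CARD(8) = 4 + 4" by simp
      have root: "\<exists>z. poly (?P u) z = 0 \<and> poly (?R u) z = 0" if "u \<in> T" for u
        using q[OF that] unfolding P R by blast
      show ?thesis
        by (rule common_root_continuation[OF eP deg(1) eR deg(2) card T cT[folded c_def] root that(1) lead]) blast+
    qed
    then obtain z :: "real \<Rightarrow> complex" where z: "poly (map_poly of_real (?P t)) (z t) = 0"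
        "poly (map_poly of_real (?R t)) (z t) = 0" if "c t \<noteq> 0" "coef4 (e t) \<noteq> 0" for t
      by metis
    interpret asymptotic k e e' e'' z
    proof
      show "eventually (\<lambda>t. poly (map_poly of_real (?P t)) (z t) = 0) at_top"
        using c0 lead by eventually_elim (rule z)
      show "eventually (\<lambda>t. poly (map_poly of_real (?R t)) (z t) = 0) at_top"
        using c0 lead by eventually_elim (rule z)
    qed (fact k e e' e'')+
    have "((\<lambda>t. 4 * C * C' * (1 / c t)) \<longlongrightarrow> 0) at_top"
      by (rule tendsto_eq_intros refl ct0 | simp)+
    moreover have "eventually (\<lambda>t. 4 * C * C' * (1 / c t) = (1 - (k t)^2) * c t) at_top"
      using c0 by eventually_elim (simp add: disc[symmetric] power2_eq_square)
    ultimately have "((\<lambda>t. (1 - (k t)^2) * c t) \<longlongrightarrow> 0) at_top"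
      by (rule Lim_transform_eventually)
    moreover have "eventually (\<lambda>t. (1 - (k t)^2) * (c t)^2 = 4 * C * C') at_top"
      using c0 by eventually_elim (rule disc)
    ultimately have "4 * C * C' = 0"
      by (rule scaled_discriminant_eq_0[OF ec e'c e''c])
    with C False show False by simp
  next
    case True
    have k1: "k t = 1" for t
      using C by (simp add: k_def c_def mode_def True)
    \<comment> \<open>The constant term \<open>2 * (1 - k^2)\<close> vanishes, so the quartic
      acquires the root 0. The nonzero values \<open>q t\<close> are roots of the remaining
      cubic.\<close>
    have PQ: "?P t = pCons 0 (?Q t)" for t
      by (simp add: quartic_def cubic_def k1)
    have "\<exists>z::complex. poly (map_poly of_real (?Q t)) z = 0 \<and> poly (map_poly of_real (?R t)) z = 0"
      if "c t \<noteq> 0" "coef4 (e t) \<noteq> 0" for t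
    proof -
      have lead: "coeff (?Q t) 3 \<noteq> 0"
        using that by (simp add: cubic_def eval_nat_numeral)
      have deg: "degree (?Q u) \<le> 3" "degree (?R u) \<le> 4" for u
        by (simp_all only: cubic_def resid_def degree_pCons4 degree_pCons5)
      have card: "CARD(7) = 3 + 4" by simp
      have root: "\<exists>z. poly (?Q u) z = 0 \<and> poly (?R u) z = 0" if "u \<in> T" for u
        using q[OF that] unfolding P R PQ by auto
      show ?thesis
        by (rule common_root_continuation[OF eQ deg(1) eR deg(2) card T cT[folded c_def] root that(1) lead]) blast+
    qed
    then obtain z :: "real \<Rightarrow> complex" where z: "poly (map_poly of_real (?Q t)) (z t) = 0"
        "poly (map_poly of_real (?R t)) (z t) = 0" if "c t \<noteq> 0" "coef4 (e t) \<noteq> 0" for t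
      by metis
    interpret asymptotic k e e' e'' z
    proof
      show "eventually (\<lambda>t. poly (map_poly of_real (?P t)) (z t) = 0) at_top"
        using c0 lead by eventually_elim (simp add: PQ map_poly_pCons z)
      show "eventually (\<lambda>t. poly (map_poly of_real (?R t)) (z t) = 0) at_top"
        using c0 lead by eventually_elim (rule z)
    qed (fact k e e' e'')+
    have "eventually (\<lambda>t. poly (map_poly of_real (?Q t)) (z t) = 0) at_top"
      using c0 lead by eventually_elim (rule z)
    from quadratic_eq_0[OF k1 c0 e_def e'_def e''_def this]
    have w: "\<alpha> = 0" "\<beta> = 0" "\<gamma> = 0" by simp_all
    obtain t where t: "t \<in> T"
      using T by (metis islimpt_EMPTY ex_in_conv)
    \<comment> \<open>With \<open>k = 1\<close> and \<open>e\<close>, \<open>e'\<close>,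
      \<open>e''\<close> zero, both polynomials coincide with their limits, whose only common root
      is 0.\<close>
    have "(q t)^2 * (1/2 + 7/4 * q t + (q t)^2) = 0"
      using q[OF t] unfolding P quartic_def
      by (simp add: coef_defs k1 e_def e'_def e''_def w power2_eq_square algebra_simps)
    moreover have "q t * (1 + 4 * q t + 23/8 * (q t)^2) = 0"
      using q[OF t] unfolding R resid_def
      by (simp add: coef_defs k1 e_def e'_def e''_def w power2_eq_square algebra_simps)
    ultimately have "q t = 0"
      using limit_bezout[of "q t"] by (metis add_0 mult_zero_right)
    with q[OF t] show False by simp
  qed
qed

text \<open>Changing the signs of \<open>C\<close> and \<open>C'\<close> preserves both polynomials,
  which covers \<open>C < 0\<close>. If \<open>C = 0\<close>, reversing \<open>t\<close> exchanges
  the two constants and sends \<open>\<beta>\<close> to \<open>- \<beta>\<close>.\<close>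

lemma no_mode:
  assumes CC: "C \<noteq> 0 \<or> C' \<noteq> 0" and T: "\<xi> islimpt T"
    and cT: "\<And>t. t \<in> T \<Longrightarrow> mode C C' t \<noteq> 0"
    and q: "\<And>t. t \<in> T \<Longrightarrow> q t \<noteq> 0 \<and> poly (quartic_at C C' \<alpha> \<beta> \<gamma> t) (q t) = 0 \<and> poly (resid_at C C' \<alpha> \<beta> \<gamma> t) (q t) = 0"
  shows False
proof -
  have growing: False
    if "C \<noteq> 0" "\<xi> islimpt T" "\<And>t. t \<in> T \<Longrightarrow> mode C C' t \<noteq> 0"
      "\<And>t. t \<in> T \<Longrightarrow> q t \<noteq> 0 \<and> poly (quartic_at C C' \<alpha> \<beta> \<gamma> t) (q t) = 0 \<and> poly (resid_at C C' \<alpha> \<beta> \<gamma> t) (q t) = 0"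
    for C C' \<alpha> \<beta> \<gamma> \<xi> and T :: "real set" and q :: "real \<Rightarrow> real"
  proof (cases "C > 0")
    case True
    then show False using no_growing_mode_pos that by blast
  next
    case False
    with that(1) have "- C > 0" by simp
    then show False
      by (rule no_growing_mode_pos[OF _ that(2), of _ "- C'" q \<alpha> \<beta> \<gamma>])
        (use that in \<open>simp_all add: mode_uminus quartic_at_uminus resid_at_uminus\<close>)
  qed
  show False
  proof (cases "C = 0")
    case False
    then show False using growing T cT q by blast
  next
    case True
    with CC have "C' \<noteq> 0" by simp
    moreover have "- \<xi> islimpt uminus ` T"
      unfolding islimpt_approachable
    proof (intro allI impI)
      fix d :: real assume "d > 0"
      then obtain t where "t \<in> T" "t \<noteq> \<xi>" "dist t \<xi> < d"
        using T unfolding islimpt_approachable by blast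
      then show "\<exists>x'\<in>uminus ` T. x' \<noteq> - \<xi> \<and> dist x' (- \<xi>) < d"
        by (intro bexI[of _ "- t"]) (auto simp: dist_real_def)
    qed
    ultimately show False
    proof (rule growing)
      fix t assume "t \<in> uminus ` T"
      then have t: "- t \<in> T" by auto
      show "mode C' C t \<noteq> 0"
        using cT[OF t] by (simp add: mode_reflect)
      show "q (- t) \<noteq> 0 \<and> poly (quartic_at C' C \<alpha> (- \<beta>) \<gamma> t) (q (- t)) = 0
          \<and> poly (resid_at C' C \<alpha> (- \<beta>) \<gamma> t) (q (- t)) = 0"
        using q[OF t] by (simp add: quartic_at_reflect resid_at_reflect)
    qed
  qed
qed

subsection \<open>Biharmonic profiles\<close>

lemma vanishing_derivative:
  fixes f :: "real \<Rightarrow> real"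
  assumes "open J" "s \<in> J" "\<And>u. u \<in> J \<Longrightarrow> f u = 0" "(f has_real_derivative D) (at s)"
  shows "D = 0"
proof -
  have "((\<lambda>_. 0) has_real_derivative D) (at s)"
    by (rule has_field_derivative_transform_within_open[OF assms(4,1,2)]) (simp add: assms(3))
  then show ?thesis
    using DERIV_unique DERIV_const by blast
qed

lemma constant_of_zero_derivative:
  fixes f :: "real \<Rightarrow> real"
  assumes "is_interval I" "\<And>s. s \<in> I \<Longrightarrow> (f has_real_derivative 0) (at s)"
  obtains K where "\<And>s. s \<in> I \<Longrightarrow> f s = K"
proof -
  have "\<exists>K. \<forall>s\<in>I. f s = K"
    using assms by (intro has_field_derivative_zero_constant)
      (auto simp: is_interval_convex intro: has_field_derivative_at_within)
  with that show ?thesis by blast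
qed

lemma DERIV_square:
  fixes f :: "real \<Rightarrow> real"
  assumes "(f has_real_derivative D) (at s)" "2 * f s * D = E"
  shows "((\<lambda>s. (f s)^2) has_real_derivative E) (at s)"
  using assms by (auto intro!: derivative_eq_intros)

lemma DERIV_cube:
  fixes f :: "real \<Rightarrow> real"
  assumes "(f has_real_derivative D) (at s)" "3 * (f s)^2 * D = E"
  shows "((\<lambda>s. (f s)^3) has_real_derivative E) (at s)"
  using assms by (auto intro!: derivative_eq_intros)

text \<open>\<open>DG\<close> is the \<open>D\<close>-derivative of \<open>G\<close> for
  \<open>D u = 1 + q - u^2\<close> and \<open>D q = q * (u + k)\<close>. By \<open>G\<close>, the
  product of \<open>u\<close> and \<open>m = 1 + q * (1 + e)\<close> is a polynomial in
  \<open>q\<close>, so multiplying \<open>DG\<close> by \<open>m^2\<close> eliminates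
  \<open>u\<close>.\<close>

lemma quartic_relation:
  fixes u q k e e' e'' :: real
  assumes G: "u * (1 + q * (1 + e)) + k + 3/4 * q * (2*k + e') = 0"
    and DG: "(1 + q - u^2) * (1 + q * (1 + e)) + u * (q * (u + k) * (1 + e) + q * (e' - 2*k*e))
      + (1 - k^2) + 3/4 * (q * (u + k)) * (2*k + e') + 3/4 * q * (2 * (1 - k^2) + e'' - 2*k*e') = 0"
  shows "poly (quartic k e e' e'') q = 0"
proof -
  define m where "m = 1 + q * (1 + e)"
  define v where "v = u * m"
  have v: "v = - (k + 3/4 * q * (2*k + e'))"
    using G by (simp add: v_def m_def)
  have "0 = m^2 * ((1 + q - u^2) * m + u * (q * (u + k) * (1 + e) + q * (e' - 2*k*e))
      + (1 - k^2) + 3/4 * (q * (u + k)) * (2*k + e') + 3/4 * q * (2 * (1 - k^2) + e'' - 2*k*e'))"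
    using DG by (simp add: m_def)
  also have "\<dots> = (1 + q) * m^3 - v^2 * m + v^2 * (q * (1 + e)) + v * m * (q * k * (1 + e) + q * (e' - 2*k*e))
      + (1 - k^2) * m^2 + 3/4 * q * (2*k + e') * (v * m + k * m^2) + 3/4 * q * (2 * (1 - k^2) + e'' - 2*k*e') * m^2"
    unfolding v_def by algebra
  also have "\<dots> = poly (quartic k e e' e'') q"
    unfolding quartic_def coef1_def coef2_def coef3_def coef4_def v m_def poly_pCons poly_0
    by algebra
  finally show ?thesis by simp
qed

text \<open>\<open>DP\<close> is the \<open>D\<close>-derivative of the quartic at \<open>q\<close>.
  Adding \<open>2 * k\<close> times the quartic cancels the constant term
  \<open>- 4 * k * (1 - k^2)\<close>; the rest is divisible by the nonzero \<open>q\<close>.\<close>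

lemma resid_relation:
  fixes u q k e e' e'' :: real
  assumes G: "u * (1 + q * (1 + e)) + k + 3/4 * q * (2*k + e') = 0" and q: "q \<noteq> 0"
    and P: "poly (quartic k e e' e'') q = 0"
    and DP: "- 4 * k * (1 - k^2) + (resid0 k e e' e'' - 2 * k * coef1 k e e' e'') * q
      + dcoef2 k e e' e'' * q^2 + dcoef3 k e e' e'' * q^3 + dcoef4 k e e' * q^4
      + (coef1 k e e' e'' + 2 * coef2 k e e' e'' * q + 3 * coef3 k e e' e'' * q^2 + 4 * coef4 e * q^3)
         * (q * (u + k)) = 0"
  shows "poly (resid k e e' e'') q = 0"
proof -
  have y: "(1 + q * (1 + e)) * (u + k) = q * slope k e e'"
    using G unfolding slope_def by algebra
  have "q * poly (resid k e e' e'') q = 0"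
    using y P DP
    unfolding resid_def resid1_def resid2_def resid3_def resid4_def quartic_def poly_pCons poly_0
    by algebra
  with q show ?thesis by simp
qed

text \<open>All derivatives are given in the form \<open>D f / r\<close>, and \<open>t\<close> is the conformal parameter. The letters
  \<open>X\<close>, \<open>Y\<close>, \<open>p\<close>, \<open>d\<close> stand for \<open>D x\<close>, \<open>D y\<close>, \<open>D r\<close>, \<open>D c\<close>.\<close>

locale biharmonic_profile =
  fixes I :: "real set" and t r p X Y a b c d :: "real \<Rightarrow> real" and A B :: real
  assumes I: "open I" "is_interval I"
    and r: "\<And>s. s \<in> I \<Longrightarrow> r s > 0"
    and dt: "\<And>s. s \<in> I \<Longrightarrow> (t has_real_derivative 1 / r s) (at s)"
    and dr: "\<And>s. s \<in> I \<Longrightarrow> (r has_real_derivative p s / r s) (at s)"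
    and dp: "\<And>s. s \<in> I \<Longrightarrow> (p has_real_derivative (r s + (r s)^2 * c s) / r s) (at s)"
    and dX: "\<And>s. s \<in> I \<Longrightarrow> (X has_real_derivative ((r s)^2 * a s) / r s) (at s)"
    and dY: "\<And>s. s \<in> I \<Longrightarrow> (Y has_real_derivative ((r s)^2 * b s) / r s) (at s)"
    and da: "\<And>s. s \<in> I \<Longrightarrow> (a has_real_derivative A / r s) (at s)"
    and db: "\<And>s. s \<in> I \<Longrightarrow> (b has_real_derivative B / r s) (at s)"
    and dc: "\<And>s. s \<in> I \<Longrightarrow> (c has_real_derivative d s / r s) (at s)"
    and dd: "\<And>s. s \<in> I \<Longrightarrow> (d has_real_derivative c s / r s) (at s)"
    and speed: "\<And>s. s \<in> I \<Longrightarrow> (X s)^2 + (Y s)^2 + (p s)^2 = (r s)^2"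
begin

section \<open>Differential consequences of the unit-speed condition\<close>

lemmas derivs = dt dr dp dX dY da db dc dd

lemma zero_if_derivative:
  assumes "open J" "J \<subseteq> I" "s \<in> J" "\<And>u. u \<in> J \<Longrightarrow> f u = 0" "(f has_real_derivative D / r s) (at s)"
  shows "D = 0"
proof -
  have "D / r s = 0"
    by (rule vanishing_derivative[OF assms(1,3,4,5)])
  with r[of s] assms show ?thesis by auto
qed

text \<open>The \<open>D\<close>-derivative of \<open>speed\<close>, in which the part
  \<open>2 * p * r\<close> coming from \<open>D p\<close> cancels \<open>D (r^2)\<close>.
  Geometrically, the mean curvature vector is orthogonal to the profile velocity.\<close>

lemma normal:
  assumes s: "s \<in> I"
  shows "a s * X s + b s * Y s + c s * p s = 0"
proof -
  have "2 * (r s)^2 * (a s * X s + b s * Y s + c s * p s) = 0"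
  proof (rule zero_if_derivative[OF I(1) subset_refl s])
    show "(X u)^2 + (Y u)^2 + (p u)^2 - (r u)^2 = 0" if "u \<in> I" for u
      using speed[OF that] by simp
    show "((\<lambda>s. (X s)^2 + (Y s)^2 + (p s)^2 - (r s)^2) has_real_derivative
        2 * (r s)^2 * (a s * X s + b s * Y s + c s * p s) / r s) (at s)"
      by (rule DERIV_square derivative_eq_intros derivs s refl)+ (simp only: divide_inverse, algebra)
  qed
  with r[OF s] show ?thesis by simp
qed

lemma normal_derivative:
  assumes s: "s \<in> I"
  shows "A * X s + (r s)^2 * (a s)^2 + B * Y s + (r s)^2 * (b s)^2 + d s * p s
    + c s * (r s + (r s)^2 * c s) = 0"
proof (rule zero_if_derivative[OF I(1) subset_refl s normal])
  show "((\<lambda>s. a s * X s + b s * Y s + c s * p s) has_real_derivative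
     (A * X s + (r s)^2 * (a s)^2 + B * Y s + (r s)^2 * (b s)^2 + d s * p s
        + c s * (r s + (r s)^2 * c s)) / r s) (at s)"
    by (rule DERIV_square derivative_eq_intros derivs s refl)+ (simp only: divide_inverse, algebra)
qed

text \<open>As \<open>A\<close> and \<open>B\<close> are constant, differentiating once more turns
  \<open>A * X\<close> into \<open>A * r^2 * a\<close> and likewise for \<open>Y\<close>. Thus
  \<open>X\<close> and \<open>Y\<close> disappear, and the relation is linear in
  \<open>p = D r\<close>.\<close>

lemma first_order_relation:
  assumes s: "s \<in> I"
  shows "3 * (r s)^2 * (a s * A + b s * B + c s * d s) + 2 * c s * p s + 2 * d s * r s
    + 2 * r s * p s * ((a s)^2 + (b s)^2 + (c s)^2) = 0"
proof (rule zero_if_derivative[OF I(1) subset_refl s normal_derivative])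
  show "((\<lambda>s. A * X s + (r s)^2 * (a s)^2 + B * Y s + (r s)^2 * (b s)^2 + d s * p s
        + c s * (r s + (r s)^2 * c s)) has_real_derivative
     (3 * (r s)^2 * (a s * A + b s * B + c s * d s) + 2 * c s * p s + 2 * d s * r s
    + 2 * r s * p s * ((a s)^2 + (b s)^2 + (c s)^2)) / r s) (at s)"
    by (rule DERIV_square derivative_eq_intros derivs s refl)+ (simp only: divide_inverse, algebra)
qed

lemma affine_a: obtains a0 where "\<And>s. s \<in> I \<Longrightarrow> a s = A * t s + a0"
proof -
  obtain a0 where "\<And>s. s \<in> I \<Longrightarrow> a s - A * t s = a0"
    by (rule constant_of_zero_derivative[OF I(2), of "\<lambda>s. a s - A * t s"])
      (auto intro!: derivative_eq_intros derivs)
  with that show ?thesis by (force simp: algebra_simps)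
qed

lemma affine_b: obtains b0 where "\<And>s. s \<in> I \<Longrightarrow> b s = B * t s + b0"
proof -
  obtain b0 where "\<And>s. s \<in> I \<Longrightarrow> b s - B * t s = b0"
    by (rule constant_of_zero_derivative[OF I(2), of "\<lambda>s. b s - B * t s"])
      (auto intro!: derivative_eq_intros derivs)
  with that show ?thesis by (force simp: algebra_simps)
qed

text \<open>\<open>c + d\<close> and \<open>c - d\<close> solve \<open>D f = f\<close> and
  \<open>D f = - f\<close>.\<close>

lemma exponential_c:
  obtains C C' where "\<And>s. s \<in> I \<Longrightarrow> c s = mode C C' (t s)" "\<And>s. s \<in> I \<Longrightarrow> d s = mode C (- C') (t s)"
proof -
  obtain K where K: "\<And>s. s \<in> I \<Longrightarrow> (c s + d s) * exp (- t s) = K"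
    by (rule constant_of_zero_derivative[OF I(2), of "\<lambda>s. (c s + d s) * exp (- t s)"])
      (auto intro!: derivative_eq_intros derivs simp: field_simps)
  obtain L where L: "\<And>s. s \<in> I \<Longrightarrow> (c s - d s) * exp (t s) = L"
    by (rule constant_of_zero_derivative[OF I(2), of "\<lambda>s. (c s - d s) * exp (t s)"])
      (auto intro!: derivative_eq_intros derivs simp: field_simps)
  have KL: "c s + d s = K * exp (t s)" "c s - d s = L * exp (- t s)" if "s \<in> I" for s
  proof -
    have "c s + d s = (c s + d s) * exp (- t s) * exp (t s)" "c s - d s = (c s - d s) * exp (t s) * exp (- t s)"
      by (simp_all add: mult.assoc flip: exp_add)
    then show "c s + d s = K * exp (t s)" "c s - d s = L * exp (- t s)"
      by (simp_all only: K[OF that] L[OF that])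
  qed
  show ?thesis
    by (rule that[of "K/2" "L/2"]) (use KL in \<open>fastforce simp: mode_def\<close>)+
qed

lemma inj_t: "inj_on t I"
proof (rule linorder_inj_onI')
  fix x y assume xy: "x \<in> I" "y \<in> I" "x < y"
  have "t x < t y"
  proof (rule DERIV_pos_imp_increasing[OF xy(3)])
    fix z assume "x \<le> z" "z \<le> y"
    then have "z \<in> I"
      using I(2) xy unfolding is_interval_1 by blast
    then show "\<exists>l. (t has_real_derivative l) (at z) \<and> l > 0"
      using dt r by fastforce
  qed
  then show "t x \<noteq> t y" by simp
qed

text \<open>Supplies the accumulation point for the analytic continuation; \<open>t\<close> is
  continuous and injective.\<close>

lemma islimpt_t:
  assumes J: "open J" "J \<subseteq> I" "s \<in> J"
  shows "t s islimpt t ` J"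
  unfolding islimpt_approachable
proof (intro allI impI)
  fix \<epsilon> :: real assume "\<epsilon> > 0"
  moreover have "isCont t s"
    using dt J DERIV_isCont by blast
  ultimately obtain \<delta> where \<delta>: "\<delta> > 0" "\<And>u. dist u s < \<delta> \<Longrightarrow> dist (t u) (t s) < \<epsilon>"
    unfolding continuous_at_eps_delta by (metis dist_commute)
  have "s islimpt J"
    using J by (simp add: interior_limit_point interior_open)
  then obtain u where u: "u \<in> J" "u \<noteq> s" "dist u s < \<delta>"
    using \<delta>(1) unfolding islimpt_approachable by blast
  then have "t u \<noteq> t s"
    using inj_t J by (auto dest: inj_onD)
  with u \<delta>(2) show "\<exists>x'\<in>t ` J. x' \<noteq> t s \<and> dist x' (t s) < \<epsilon>" by blast
qed

section \<open>Normalised quantities where the radial curvature component is nonzero\<close>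

definition qq :: "real \<Rightarrow> real" where "qq s = r s * c s"
definition uu :: "real \<Rightarrow> real" where "uu s = p s / r s"
definition kk :: "real \<Rightarrow> real" where "kk s = d s / c s"
definition ee :: "real \<Rightarrow> real" where "ee s = ((a s)^2 + (b s)^2) / (c s)^2"
definition ee' :: "real \<Rightarrow> real" where "ee' s = 2 * (a s * A + b s * B) / (c s)^2"
definition ee'' :: "real \<Rightarrow> real" where "ee'' s = 2 * (A^2 + B^2) / (c s)^2"

context
  fixes s assumes s: "s \<in> I" and c0: "c s \<noteq> 0"
begin

lemma
  shows dqq: "(qq has_real_derivative (qq s * (uu s + kk s)) / r s) (at s)"
    and duu: "(uu has_real_derivative (1 + qq s - (uu s)^2) / r s) (at s)"
    and dkk: "(kk has_real_derivative (1 - (kk s)^2) / r s) (at s)"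
    and dee: "(ee has_real_derivative (ee' s - 2 * kk s * ee s) / r s) (at s)"
    and dee': "(ee' has_real_derivative (ee'' s - 2 * kk s * ee' s) / r s) (at s)"
    and dee'': "(ee'' has_real_derivative (- 2 * kk s * ee'' s) / r s) (at s)"
proof -
  \<comment> \<open>With \<open>inverse (r s)\<close> and \<open>inverse (c s)\<close> as symbols
    subject to these two relations, the derivative formulas become polynomial identities.\<close>
  note inv = r[OF s, THEN less_imp_neq, THEN not_sym, THEN right_inverse] right_inverse[OF c0]
  have dr': "((\<lambda>s. inverse (r s)) has_real_derivative - (p s * inverse (r s)) * (inverse (r s))^2) (at s)"
    using r[OF s] by (auto intro!: derivative_eq_intros derivs s simp: divide_inverse power2_eq_square)
  have dc': "((\<lambda>s. inverse (c s)) has_real_derivative - (d s * inverse (r s)) * (inverse (c s))^2) (at s)"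
    using c0 by (auto intro!: derivative_eq_intros derivs s simp: divide_inverse power2_eq_square)
  note defs = qq_def[abs_def] uu_def[abs_def] kk_def[abs_def] ee_def[abs_def] ee'_def[abs_def] ee''_def[abs_def]
    divide_inverse power_inverse[symmetric]
  note D = derivs[unfolded divide_inverse, OF s]
  show "(qq has_real_derivative (qq s * (uu s + kk s)) / r s) (at s)"
    unfolding defs by (rule DERIV_square dr' dc' D derivative_eq_intros refl)+ (algebra | use inv in algebra)
  show "(uu has_real_derivative (1 + qq s - (uu s)^2) / r s) (at s)"
    unfolding defs by (rule DERIV_square dr' dc' D derivative_eq_intros refl)+ (algebra | use inv in algebra)
  show "(kk has_real_derivative (1 - (kk s)^2) / r s) (at s)"
    unfolding defs by (rule DERIV_square dr' dc' D derivative_eq_intros refl)+ (algebra | use inv in algebra)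
  show "(ee has_real_derivative (ee' s - 2 * kk s * ee s) / r s) (at s)"
    unfolding defs by (rule DERIV_square dr' dc' D derivative_eq_intros refl)+ (algebra | use inv in algebra)
  show "(ee' has_real_derivative (ee'' s - 2 * kk s * ee' s) / r s) (at s)"
    unfolding defs by (rule DERIV_square dr' dc' D derivative_eq_intros refl)+ (algebra | use inv in algebra)
  show "(ee'' has_real_derivative (- 2 * kk s * ee'' s) / r s) (at s)"
    unfolding defs by (rule DERIV_square dr' dc' D derivative_eq_intros refl)+ (algebra | use inv in algebra)
qed

lemmas dderivs = dqq duu dkk dee dee' dee''

lemma
  shows dcoef1: "((\<lambda>s. coef1 (kk s) (ee s) (ee' s) (ee'' s)) has_real_derivative
      (resid0 (kk s) (ee s) (ee' s) (ee'' s) - 2 * kk s * coef1 (kk s) (ee s) (ee' s) (ee'' s)) / r s) (at s)"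
    and dcoef2: "((\<lambda>s. coef2 (kk s) (ee s) (ee' s) (ee'' s)) has_real_derivative
      dcoef2 (kk s) (ee s) (ee' s) (ee'' s) / r s) (at s)"
    and dcoef3: "((\<lambda>s. coef3 (kk s) (ee s) (ee' s) (ee'' s)) has_real_derivative
      dcoef3 (kk s) (ee s) (ee' s) (ee'' s) / r s) (at s)"
    and dcoef4: "((\<lambda>s. coef4 (ee s)) has_real_derivative dcoef4 (kk s) (ee s) (ee' s) / r s) (at s)"
proof -
  show "((\<lambda>s. coef1 (kk s) (ee s) (ee' s) (ee'' s)) has_real_derivative
      (resid0 (kk s) (ee s) (ee' s) (ee'' s) - 2 * kk s * coef1 (kk s) (ee s) (ee' s) (ee'' s)) / r s) (at s)"
    unfolding coef1_def resid0_def
    by (rule DERIV_square DERIV_cube dderivs derivative_eq_intros refl)+ (simp only: divide_inverse, algebra)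
  show "((\<lambda>s. coef2 (kk s) (ee s) (ee' s) (ee'' s)) has_real_derivative
      dcoef2 (kk s) (ee s) (ee' s) (ee'' s) / r s) (at s)"
    unfolding coef2_def dcoef2_def
    by (rule DERIV_square DERIV_cube dderivs derivative_eq_intros refl)+ (simp only: divide_inverse, algebra)
  show "((\<lambda>s. coef3 (kk s) (ee s) (ee' s) (ee'' s)) has_real_derivative
      dcoef3 (kk s) (ee s) (ee' s) (ee'' s) / r s) (at s)"
    unfolding coef3_def dcoef3_def
    by (rule DERIV_square DERIV_cube dderivs derivative_eq_intros refl)+ (simp only: divide_inverse, algebra)
  show "((\<lambda>s. coef4 (ee s)) has_real_derivative dcoef4 (kk s) (ee s) (ee' s) / r s) (at s)"
    unfolding coef4_def dcoef4_def
    by (rule DERIV_square DERIV_cube dderivs derivative_eq_intros refl)+ (simp only: divide_inverse, algebra)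
qed

end

text \<open>This is \<open>first_order_relation\<close> divided by \<open>2 * r * c\<close>.\<close>

lemma scaled_relation:
  assumes s: "s \<in> I" and c0: "c s \<noteq> 0"
  shows "uu s * (1 + qq s * (1 + ee s)) + kk s + 3/4 * qq s * (2 * kk s + ee' s) = 0"
proof -
  have "2 * r s * c s * (uu s * (1 + qq s * (1 + ee s)) + kk s + 3/4 * qq s * (2 * kk s + ee' s)) = 0"
    using first_order_relation[OF s] r[OF s, THEN less_imp_neq, THEN not_sym, THEN right_inverse]
      right_inverse[OF c0]
    unfolding qq_def uu_def kk_def ee_def ee'_def divide_inverse power_inverse[symmetric] by algebra
  with c0 r[OF s] show ?thesis by simp
qed

text \<open>Openness allows relations that hold only where \<open>c\<close> is nonzero to be
  differentiated.\<close>

lemma open_support: "open {s \<in> I. c s \<noteq> 0}"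
proof -
  have "continuous_on I c"
    using dc by (meson DERIV_isCont continuous_at_imp_continuous_on)
  then have "open (I \<inter> c -` (- {0}))"
    by (rule continuous_open_preimage) (auto simp: I)
  moreover have "I \<inter> c -` (- {0}) = {s \<in> I. c s \<noteq> 0}" by auto
  ultimately show ?thesis by simp
qed

lemma quartic_root:
  assumes s: "s \<in> I" and c0: "c s \<noteq> 0"
  shows "poly (quartic (kk s) (ee s) (ee' s) (ee'' s)) (qq s) = 0"
proof (rule quartic_relation[OF scaled_relation[OF s c0]], rule zero_if_derivative[OF open_support])
  show "((\<lambda>s. uu s * (1 + qq s * (1 + ee s)) + kk s + 3/4 * qq s * (2 * kk s + ee' s)) has_real_derivative
    ((1 + qq s - (uu s)^2) * (1 + qq s * (1 + ee s))
      + uu s * (qq s * (uu s + kk s) * (1 + ee s) + qq s * (ee' s - 2 * kk s * ee s))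
      + (1 - (kk s)^2) + 3/4 * (qq s * (uu s + kk s)) * (2 * kk s + ee' s)
      + 3/4 * qq s * (2 * (1 - (kk s)^2) + ee'' s - 2 * kk s * ee' s)) / r s) (at s)"
    by (rule DERIV_square DERIV_cube derivative_eq_intros dderivs s c0 refl)+ (simp only: divide_inverse, algebra)
qed (use s c0 scaled_relation in auto)

lemma resid_root:
  assumes s: "s \<in> I" and c0: "c s \<noteq> 0"
  shows "poly (resid (kk s) (ee s) (ee' s) (ee'' s)) (qq s) = 0"
proof (rule resid_relation[OF scaled_relation[OF s c0] _ quartic_root[OF s c0]])
  show "qq s \<noteq> 0"
    using c0 r[OF s] by (simp add: qq_def)
  show "- 4 * kk s * (1 - (kk s)^2)
      + (resid0 (kk s) (ee s) (ee' s) (ee'' s) - 2 * kk s * coef1 (kk s) (ee s) (ee' s) (ee'' s)) * qq s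
      + dcoef2 (kk s) (ee s) (ee' s) (ee'' s) * (qq s)^2 + dcoef3 (kk s) (ee s) (ee' s) (ee'' s) * (qq s)^3
      + dcoef4 (kk s) (ee s) (ee' s) * (qq s)^4
      + (coef1 (kk s) (ee s) (ee' s) (ee'' s) + 2 * coef2 (kk s) (ee s) (ee' s) (ee'' s) * qq s
        + 3 * coef3 (kk s) (ee s) (ee' s) (ee'' s) * (qq s)^2 + 4 * coef4 (ee s) * (qq s)^3)
        * (qq s * (uu s + kk s)) = 0" (is "?D = 0")
  proof (rule zero_if_derivative[OF open_support])
    show "((\<lambda>s. poly (quartic (kk s) (ee s) (ee' s) (ee'' s)) (qq s)) has_real_derivative ?D / r s) (at s)"
      unfolding quartic_def poly_pCons poly_0
      by (rule DERIV_square DERIV_cube derivative_eq_intros dderivs dcoef1 dcoef2 dcoef3 dcoef4 s c0 refl)+ (simp only: divide_inverse, algebra)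
  qed (use s c0 quartic_root in auto)
qed

theorem mean_curvature_components_0:
  assumes s: "s \<in> I"
  shows "a s = 0 \<and> b s = 0 \<and> c s = 0"
proof -
  obtain a0 where a: "\<And>s. s \<in> I \<Longrightarrow> a s = A * t s + a0" by (rule affine_a) blast
  obtain b0 where b: "\<And>s. s \<in> I \<Longrightarrow> b s = B * t s + b0" by (rule affine_b) blast
  obtain C C' where c: "\<And>s. s \<in> I \<Longrightarrow> c s = mode C C' (t s)"
    and d: "\<And>s. s \<in> I \<Longrightarrow> d s = mode C (- C') (t s)"
    by (rule exponential_c) blast
  define \<alpha> \<beta> \<gamma> where "\<alpha> = A^2 + B^2" and "\<beta> = 2 * (A * a0 + B * b0)" and "\<gamma> = a0^2 + b0^2"
  have w: "(a s)^2 + (b s)^2 = \<alpha> * (t s)^2 + \<beta> * t s + \<gamma>"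
    and w': "2 * (a s * A + b s * B) = 2 * \<alpha> * t s + \<beta>" if "s \<in> I" for s
    unfolding a[OF that] b[OF that] \<alpha>_def \<beta>_def \<gamma>_def by algebra+
  have CC: "C = 0 \<and> C' = 0"
  proof (rule ccontr)
    assume nz: "\<not> (C = 0 \<and> C' = 0)"
    define J where "J = {s \<in> I. c s \<noteq> 0}"
    have J: "open J" "J \<subseteq> I"
      using open_support by (auto simp: J_def)
    \<comment> \<open>If \<open>c\<close> vanished on all of \<open>I\<close>, so would
      \<open>d\<close>; the two modes at a single point then give \<open>C = C' = 0\<close>.\<close>
    have "\<exists>s0. s0 \<in> J"
    proof (rule ccontr)
      assume "\<nexists>s0. s0 \<in> J"
      then have c_zero: "c u = 0" if "u \<in> I" for u using that by (auto simp: J_def)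
      have "d s = 0"
        by (rule zero_if_derivative[OF I(1) subset_refl s c_zero dc[OF s]])
      then have "mode C C' (t s) = 0" "mode C (- C') (t s) = 0"
        using c[OF s] d[OF s] c_zero[OF s] by auto
      then show False
        using nz by (simp add: mode_def)
    qed
    then obtain s0 where s0: "s0 \<in> J" by blast
    have inv: "inv_into I t (t s) = s" if "s \<in> I" for s
      using inj_t that by simp
    show False
    proof (rule no_mode[of C C' "t s0" "t ` J" "\<lambda>\<tau>. qq (inv_into I t \<tau>)" \<alpha> \<beta> \<gamma>])
      show "C \<noteq> 0 \<or> C' \<noteq> 0" using nz by blast
      show "t s0 islimpt t ` J"
        by (rule islimpt_t[OF J s0])
      fix \<tau> assume "\<tau> \<in> t ` J"
      then obtain s where s: "\<tau> = t s" "s \<in> I" "c s \<noteq> 0"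
        by (auto simp: J_def)
      then show "mode C C' \<tau> \<noteq> 0"
        using c by simp
      have "quartic_at C C' \<alpha> \<beta> \<gamma> \<tau> = quartic (kk s) (ee s) (ee' s) (ee'' s)"
        "resid_at C C' \<alpha> \<beta> \<gamma> \<tau> = resid (kk s) (ee s) (ee' s) (ee'' s)"
        unfolding quartic_at_def resid_at_def kk_def ee_def ee'_def ee''_def w[OF s(2)] w'[OF s(2)]
          s(1) c[OF s(2)] d[OF s(2)] \<alpha>_def by (rule refl)+
      then show "qq (inv_into I t \<tau>) \<noteq> 0 \<and> poly (quartic_at C C' \<alpha> \<beta> \<gamma> \<tau>) (qq (inv_into I t \<tau>)) = 0
          \<and> poly (resid_at C C' \<alpha> \<beta> \<gamma> \<tau>) (qq (inv_into I t \<tau>)) = 0"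
        using s quartic_root[OF s(2,3)] resid_root[OF s(2,3)] r[OF s(2)] by (simp add: inv qq_def)
    qed
  qed
  then have c_zero: "c u = 0" and d_zero: "d u = 0" if "u \<in> I" for u
    using c[OF that] d[OF that] by (simp_all add: mode_def)
  define w where "w u = \<alpha> * (t u)^2 + \<beta> * t u + \<gamma>" for u
  define w1 where "w1 u = 2 * \<alpha> * t u + \<beta>" for u
  \<comment> \<open>For \<open>c = d = 0\<close> this is \<open>first_order_relation\<close> times 2
    and divided by \<open>r\<close>, with \<open>w = a^2 + b^2\<close> and \<open>w1\<close> its
    \<open>D\<close>-derivative.\<close>
  have rel: "3 * r u * w1 u + 4 * p u * w u = 0" if u: "u \<in> I" for u
  proof -
    have "3 * (r u)^2 * (a u * A + b u * B) + 2 * r u * p u * ((a u)^2 + (b u)^2) = 0"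
      using first_order_relation[OF u] by (simp add: c_zero[OF u] d_zero[OF u])
    then have "r u * (3 * r u * w1 u + 4 * p u * w u) = 0"
      using w[OF u] w'[OF u] unfolding w_def w1_def by algebra
    with r[OF u] show ?thesis by simp
  qed
  \<comment> \<open>The expansion in powers of \<open>t\<close> of
    \<open>4 * w^2 + 6 * \<alpha> * w - 21/4 * w1^2\<close>, which arises by eliminating
    \<open>p\<close> between \<open>rel\<close> and its \<open>D\<close>-derivative.\<close>
  let ?w = "[:4 * \<gamma>^2 + 6 * \<alpha> * \<gamma> - 21/4 * \<beta>^2, 8 * \<beta> * \<gamma> - 15 * \<alpha> * \<beta>, 8 * \<alpha> * \<gamma> + 4 * \<beta>^2 - 15 * \<alpha>^2, 8 * \<alpha> * \<beta>, 4 * \<alpha>^2:]"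
  have "poly ?w (t u) = 0"
    if u: "u \<in> I" for u
  proof -
    have "7 * p u * w1 u + 6 * \<alpha> * r u + 4 * r u * w u = 0"
    proof (rule zero_if_derivative[OF I(1) subset_refl u rel])
      show "((\<lambda>u. 3 * r u * w1 u + 4 * p u * w u) has_real_derivative
          (7 * p u * w1 u + 6 * \<alpha> * r u + 4 * r u * w u) / r u) (at u)"
        unfolding w_def w1_def
        by (rule DERIV_square derivs u derivative_eq_intros refl)+
          (simp only: divide_inverse, use c_zero[OF u] in algebra)
    qed
    then have "r u * (4 * (w u)^2 + 6 * \<alpha> * w u - 21/4 * (w1 u)^2) = 0"
      using rel[OF u] by algebra
    then have "4 * (w u)^2 + 6 * \<alpha> * w u - 21/4 * (w1 u)^2 = 0"
      using r[OF u] by simp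
    then show ?thesis
      unfolding w_def w1_def poly_pCons poly_0 by algebra
  qed
  then have "t ` I \<subseteq> {\<tau>. poly ?w \<tau> = 0}"
    by blast
  moreover have "infinite (t ` I)"
    using islimpt_t[OF I(1) subset_refl s] islimpt_finite by blast
  ultimately have "infinite {\<tau>. poly ?w \<tau> = 0}"
    using finite_subset by blast
  then have "?w = 0"
    using poly_roots_finite by blast
  \<comment> \<open>The quartic coefficient gives \<open>\<alpha> = 0\<close>, then the quadratic
    one \<open>\<beta> = 0\<close>, then the constant one \<open>\<gamma> = 0\<close>.\<close>
  then have "\<alpha> = 0 \<and> \<beta> = 0 \<and> \<gamma> = 0"
    by auto
  then have "(a s)^2 + (b s)^2 = 0"
    using w[OF s] by simp
  with c_zero[OF s] show ?thesis
    by (simp add: sum_power2_eq_zero_iff)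
qed

end

subsection \<open>The Laplacian of a rotational surface\<close>

lemma smooth_on_iterate:
  assumes "smooth_on I f" "s \<in> I"
  shows "(f has_real_derivative deriv f s) (at s)"
    and "(deriv f has_real_derivative deriv (deriv f) s) (at s)"
    and "(deriv (deriv f) has_real_derivative deriv (deriv (deriv f)) s) (at s)"
    and "(deriv (deriv (deriv f)) has_real_derivative deriv (deriv (deriv (deriv f))) s) (at s)"
proof -
  have "((deriv ^^ n) f has_real_derivative deriv ((deriv ^^ n) f) s) (at s)" for n
    using assms unfolding smooth_on_def
    by (meson DERIV_deriv_iff_real_differentiable)
  from this[of 0] this[of 1] this[of 2] this[of 3]
  show "(f has_real_derivative deriv f s) (at s)"
    and "(deriv f has_real_derivative deriv (deriv f) s) (at s)"
    and "(deriv (deriv f) has_real_derivative deriv (deriv (deriv f)) s) (at s)"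
    and "(deriv (deriv (deriv f)) has_real_derivative deriv (deriv (deriv (deriv f))) s) (at s)"
    by (simp_all add: eval_nat_numeral)
qed

text \<open>Separation of variables with an angular eigenfunction \<open>g\<close>:
  \<open>\<kappa>\<close> is 0 for the first two components and -1 for the rotating ones. The
  factorisation is required on all of \<open>I\<close> because the outer derivative at
  \<open>s\<close> sees nearby values.\<close>

lemma lap_scalar_separated:
  assumes I: "open I" "s \<in> I"
    and Y: "\<And>u \<phi>. u \<in> I \<Longrightarrow> Y u \<phi> = f u * g \<phi>"
    and f: "\<And>u. u \<in> I \<Longrightarrow> (f has_real_derivative f' u) (at u)"
    and rf: "((\<lambda>u. r u * f' u) has_real_derivative F) (at s)"
    and g: "\<And>\<phi>. (g has_real_derivative g' \<phi>) (at \<phi>)" "\<And>\<phi>. (g' has_real_derivative \<kappa> * g \<phi>) (at \<phi>)"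
  shows "lap_scalar r Y s \<theta> = (F / r s + \<kappa> * f s / (r s)^2) * g \<theta>"
proof -
  have dY: "deriv (\<lambda>u. Y u \<theta>) t = f' t * g \<theta>" if "t \<in> I" for t
  proof (rule DERIV_imp_deriv, rule has_field_derivative_transform_within_open[OF _ I(1) that])
    show "((\<lambda>u. f u * g \<theta>) has_real_derivative f' t * g \<theta>) (at t)"
      by (rule DERIV_cmult_right[OF f[OF that]])
  qed (simp add: Y)
  have "deriv (\<lambda>t. r t * deriv (\<lambda>u. Y u \<theta>) t) s = F * g \<theta>"
  proof (rule DERIV_imp_deriv, rule has_field_derivative_transform_within_open[OF _ I])
    show "((\<lambda>t. r t * f' t * g \<theta>) has_real_derivative F * g \<theta>) (at s)"
      by (rule DERIV_cmult_right[OF rf])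
  qed (simp add: dY)
  moreover have "deriv (\<lambda>\<phi>. Y s \<phi>) = (\<lambda>\<phi>. f s * g' \<phi>)"
    using I by (auto simp: Y intro!: DERIV_imp_deriv DERIV_cmult g)
  moreover have "deriv (\<lambda>\<phi>. f s * g' \<phi>) \<theta> = f s * (\<kappa> * g \<theta>)"
    by (intro DERIV_imp_deriv DERIV_cmult g)
  ultimately show ?thesis
    by (simp add: lap_scalar_def algebra_simps)
qed

definition radial_lap :: "(real \<Rightarrow> real) \<Rightarrow> (real \<Rightarrow> real) \<Rightarrow> real \<Rightarrow> real" where
  "radial_lap r f s = deriv (deriv f) s + deriv r s * deriv f s / r s"

text \<open>The derivative of \<open>radial_lap r f\<close>, written out so that differentiating
  again meets only iterated derivatives of \<open>r\<close> and \<open>f\<close>, which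
  \<open>smooth_on\<close> controls.\<close>

definition radial_lap' :: "(real \<Rightarrow> real) \<Rightarrow> (real \<Rightarrow> real) \<Rightarrow> real \<Rightarrow> real" where
  "radial_lap' r f s = deriv (deriv (deriv f)) s
     + (deriv (deriv r) s * deriv f s + deriv r s * deriv (deriv f) s) / r s
     - (deriv r s)^2 * deriv f s / (r s)^2"

context
  fixes I :: "real set" and r f :: "real \<Rightarrow> real"
  assumes r: "smooth_on I r" "\<And>s. s \<in> I \<Longrightarrow> r s > 0" and f: "smooth_on I f"
begin

lemma DERIV_radial_flux:
  assumes "s \<in> I"
  shows "((\<lambda>t. r t * deriv f t) has_real_derivative r s * radial_lap r f s) (at s)"
proof -
  have "((\<lambda>t. r t * deriv f t) has_real_derivative deriv r s * deriv f s + deriv (deriv f) s * r s) (at s)"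
    by (rule DERIV_mult[OF smooth_on_iterate(1)[OF r(1) assms] smooth_on_iterate(2)[OF f assms]])
  moreover have "deriv r s * deriv f s + deriv (deriv f) s * r s = r s * radial_lap r f s"
    using r(2)[OF assms] by (simp add: radial_lap_def distrib_left)
  ultimately show ?thesis by (simp only:)
qed

lemma DERIV_radial_lap:
  assumes "s \<in> I"
  shows "(radial_lap r f has_real_derivative radial_lap' r f s) (at s)"
proof -
  have quotient: "((x * z' + x' * z) * y - (z * x) * z) / (y * y) = (z' * x + z * x') / y - z^2 * x / y^2"
    if "y > 0" for x x' y z z' :: real
    using that by (simp add: field_simps power2_eq_square)
  have "(radial_lap r f has_real_derivative deriv (deriv (deriv f)) s
     + ((deriv (deriv r) s * deriv f s + deriv (deriv f) s * deriv r s) * r s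
        - (deriv r s * deriv f s) * deriv r s) / (r s * r s)) (at s)"
    unfolding radial_lap_def[abs_def]
    by (intro DERIV_add DERIV_divide DERIV_mult smooth_on_iterate[OF r(1) assms] smooth_on_iterate[OF f assms])
      (use r(2)[OF assms] in simp)
  moreover have "deriv (deriv (deriv f)) s
     + ((deriv (deriv r) s * deriv f s + deriv (deriv f) s * deriv r s) * r s
        - (deriv r s * deriv f s) * deriv r s) / (r s * r s) = radial_lap' r f s"
    using quotient[OF r(2)[OF assms], of "deriv f s" "deriv (deriv r) s" "deriv (deriv f) s" "deriv r s"]
    by (simp add: radial_lap'_def mult.commute)
  ultimately show ?thesis by (simp only:)
qed

lemma differentiable_radial_lap':
  assumes "s \<in> I"
  obtains D where "(radial_lap' r f has_real_derivative D) (at s)"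
proof -
  have D: "deriv r differentiable at s" "deriv (deriv r) differentiable at s" "r differentiable at s"
    "deriv f differentiable at s" "deriv (deriv f) differentiable at s" "deriv (deriv (deriv f)) differentiable at s"
    using smooth_on_iterate[OF r(1) assms] smooth_on_iterate[OF f assms] unfolding real_differentiable_def by blast+
  have "radial_lap' r f differentiable at s"
    unfolding radial_lap'_def[abs_def]
    by (intro differentiable_add differentiable_diff differentiable_mult differentiable_divide differentiable_power D)
      (use r(2)[OF assms] in auto)
  with that show ?thesis
    by (auto simp: real_differentiable_def)
qed

end

text \<open>Applied to \<open>1 / r\<close>, this provides the conformal parameter.\<close>

lemma antiderivative_open_interval:
  fixes f :: "real \<Rightarrow> real"
  assumes I: "open I" "is_interval I" and f: "continuous_on I f"
  obtains F where "\<And>s. s \<in> I \<Longrightarrow> (F has_real_derivative f s) (at s)"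
proof (cases "I = {}")
  case True
  with that show ?thesis by blast
next
  case False
  then obtain s0 where s0: "s0 \<in> I" by blast
  define F where "F u = (LBINT y=s0..u. f y)" for u :: real
  have "(F has_real_derivative f s) (at s)" if s: "s \<in> I" for s
  proof -
    obtain e1 where e1: "e1 > 0" "cball s e1 \<subseteq> I"
      using I(1) s open_contains_cball by blast
    \<comment> \<open>\<open>{a..b}\<close> contains the base point and has \<open>s\<close> in its
      interior, so the derivative within it is the two-sided one.\<close>
    obtain a b where ab: "a \<in> I" "b \<in> I" "a < s" "s < b" "a \<le> s0" "s0 \<le> b"
    proof
      show "min (s - e1) s0 \<in> I" "max (s + e1) s0 \<in> I"
        using e1 s0 by (auto simp: min_def max_def dist_real_def intro!: subsetD[OF e1(2)])
    qed (use e1 in auto)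
    have "{a..b} \<subseteq> I"
      using mem_is_interval_1_I[OF I(2) ab(1,2)] by auto
    then have "(F has_vector_derivative f s) (at s within {a..b})"
      unfolding F_def using ab continuous_on_subset[OF f]
      by (intro interval_integral_FTC2) auto
    then have "(F has_vector_derivative f s) (at s within {a<..<b})"
      by (rule has_vector_derivative_within_subset) auto
    then show ?thesis
      using ab by (simp add: has_real_derivative_iff_has_vector_derivative at_within_open[of s "{a<..<b}"])
  qed
  with that show ?thesis by blast
qed

lemma vector_4:
  "(vector [a, b, c, d] :: 'a::zero^4) $ 1 = a"
  "(vector [a, b, c, d] :: 'a::zero^4) $ 2 = b"
  "(vector [a, b, c, d] :: 'a::zero^4) $ 3 = c"
  "(vector [a, b, c, d] :: 'a::zero^4) $ 4 = d"
  unfolding vector_def by simp_all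

lemma mean_curv_nth:
  assumes I: "open I" "s \<in> I" and f: "smooth_on I f" and r: "smooth_on I r" "\<And>s. s \<in> I \<Longrightarrow> r s > 0"
    and X: "\<And>u \<phi>. rot_surface x y r u \<phi> $ i = f u * g \<phi>"
    and g: "\<And>\<phi>. (g has_real_derivative g' \<phi>) (at \<phi>)" "\<And>\<phi>. (g' has_real_derivative \<kappa> * g \<phi>) (at \<phi>)"
  shows "mean_curv x y r s \<theta> $ i = 1/2 * (radial_lap r f s + \<kappa> * f s / (r s)^2) * g \<theta>"
proof -
  have "lap_scalar r (\<lambda>u \<phi>. rot_surface x y r u \<phi> $ i) s \<theta>
      = (r s * radial_lap r f s / r s + \<kappa> * f s / (r s)^2) * g \<theta>"
    by (rule lap_scalar_separated[OF I X _ _ g])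
      (use smooth_on_iterate(1)[OF f] DERIV_radial_flux[OF r f I(2)] in auto)
  then show ?thesis
    using r(2)[OF I(2)] by (simp add: mean_curv_def lap_def)
qed

theorem theorem1p1:
  fixes x y r :: "real \<Rightarrow> real" and I :: "real set"
  assumes "open I" and "is_interval I" and "I \<noteq> {}"
    and "smooth_on I x" and "smooth_on I y" and "smooth_on I r"
    and "\<forall>s\<in>I. r s > 0"
    and "\<forall>s\<in>I. (deriv x s)^2 + (deriv y s)^2 + (deriv r s)^2 = 1"
    and "\<forall>s\<in>I. \<forall>\<theta>. lap r (mean_curv x y r) s \<theta> = 0"
  shows "\<forall>s\<in>I. \<forall>\<theta>. mean_curv x y r s \<theta> = 0"
proof -
  note I = assms(1,2) and x = assms(4) and y = assms(5)
  have r: "smooth_on I r" "\<And>s. s \<in> I \<Longrightarrow> r s > 0"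
    using assms(6,7) by auto
  \<comment> \<open>Twice the radial component of the mean curvature vector; \<open>- 1 / r\<close>
    comes from the second angular derivative of \<open>cos\<close> and \<open>sin\<close>.\<close>
  define c where "c s = radial_lap r r s - 1 / r s" for s
  define c' where "c' s = radial_lap' r r s + deriv r s / (r s)^2" for s
  have dr: "(r has_real_derivative deriv r s) (at s)" if "s \<in> I" for s
    by (rule smooth_on_iterate(1)[OF r(1) that])
  have const: "((\<lambda>_. 1) has_real_derivative 0) (at \<phi>)" "((\<lambda>_. 0) has_real_derivative 0 * 1) (at \<phi>)" for \<phi> :: real
    by auto
  have cos: "(cos has_real_derivative - sin \<phi>) (at \<phi>)" "((\<lambda>\<phi>. - sin \<phi>) has_real_derivative -1 * cos \<phi>) (at \<phi>)"
    and sin: "(sin has_real_derivative cos \<phi>) (at \<phi>)" "(cos has_real_derivative -1 * sin \<phi>) (at \<phi>)" for \<phi> :: real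
    by (auto intro!: derivative_eq_intros)
  have c_alt: "radial_lap r r s + -1 * r s / (r s)^2 = c s" if "s \<in> I" for s
    using r(2)[OF that] by (simp add: c_def power2_eq_square)
  have rot: "rot_surface x y r u \<phi> $ 1 = x u * 1" "rot_surface x y r u \<phi> $ 2 = y u * 1"
    "rot_surface x y r u \<phi> $ 3 = r u * cos \<phi>" "rot_surface x y r u \<phi> $ 4 = r u * sin \<phi>" for u \<phi>
    by (simp_all add: rot_surface_def vector_4)
  have H1: "mean_curv x y r s \<theta> $ 1 = 1/2 * radial_lap r x s * 1"
    and H2: "mean_curv x y r s \<theta> $ 2 = 1/2 * radial_lap r y s * 1"
    and H3: "mean_curv x y r s \<theta> $ 3 = 1/2 * c s * cos \<theta>"
    and H4: "mean_curv x y r s \<theta> $ 4 = 1/2 * c s * sin \<theta>" if s: "s \<in> I" for s \<theta>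
    using mean_curv_nth[OF I(1) s x r rot(1) const, of \<theta>] mean_curv_nth[OF I(1) s y r rot(2) const, of \<theta>]
      mean_curv_nth[OF I(1) s r(1) r rot(3) cos, of \<theta>] mean_curv_nth[OF I(1) s r(1) r rot(4) sin, of \<theta>]
    by (simp_all only: c_alt[OF s] mult_zero_left div_0 add_0_right)
  \<comment> \<open>For a component independent of the angle, harmonicity says that \<open>r\<close>
    times its derivative is constant; this produces \<open>A\<close> and \<open>B\<close>.\<close>
  have flux0: "((\<lambda>t. r t * radial_lap' r f t) has_real_derivative 0) (at s)"
    if f: "smooth_on I f" and H: "\<And>s \<theta>. s \<in> I \<Longrightarrow> mean_curv x y r s \<theta> $ i = 1/2 * radial_lap r f s * 1"
      and s: "s \<in> I" for f i s
  proof -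
    obtain D where D: "(radial_lap' r f has_real_derivative D) (at s)"
      by (rule differentiable_radial_lap'[OF r f s])
    let ?F = "deriv r s * radial_lap' r f s + D * r s"
    have rf: "((\<lambda>t. r t * radial_lap' r f t) has_real_derivative ?F) (at s)"
      by (rule DERIV_mult[OF dr[OF s] D])
    have "lap r (mean_curv x y r) s 0 $ i = (1/2 * ?F / r s + 0 * (1/2 * radial_lap r f s) / (r s)^2) * 1"
      unfolding lap_def vec_lambda_beta
    proof (rule lap_scalar_separated[OF I(1) s H _ _ const])
      show "((\<lambda>s. 1/2 * radial_lap r f s) has_real_derivative 1/2 * radial_lap' r f u) (at u)" if "u \<in> I" for u
        by (rule DERIV_cmult[OF DERIV_radial_lap[OF r f that]])
      show "((\<lambda>u. r u * (1/2 * radial_lap' r f u)) has_real_derivative 1/2 * ?F) (at s)"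
        using DERIV_cmult[OF rf, of "1/2"] by (simp add: mult_ac)
    qed
    then have "?F = 0"
      using assms(9) s r(2)[OF s] by simp
    with rf show ?thesis by simp
  qed
  have dc: "(c has_real_derivative c' s) (at s)" if s: "s \<in> I" for s
  proof -
    have "((\<lambda>s. radial_lap r r s - 1 / r s) has_real_derivative
        radial_lap' r r s - (0 * r s - 1 * deriv r s) / (r s * r s)) (at s)"
      by (intro DERIV_diff DERIV_divide DERIV_const dr s DERIV_radial_lap[OF r r(1)]
          r(2)[OF s, THEN less_imp_neq, THEN not_sym])
    then show ?thesis
      by (simp add: c_def[abs_def] c'_def power2_eq_square)
  qed
  \<comment> \<open>The equation \<open>D^2 c = c\<close>, read off from the third component at
    angle 0, where \<open>cos\<close> is 1.\<close>
  have dd: "((\<lambda>s. r s * c' s) has_real_derivative c s / r s) (at s)" if s: "s \<in> I" for s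
  proof -
    obtain D where D: "(radial_lap' r r has_real_derivative D) (at s)"
      by (rule differentiable_radial_lap'[OF r r(1) s])
    have "c' differentiable at s"
    proof -
      have "deriv r differentiable at s" "r differentiable at s" "radial_lap' r r differentiable at s"
        using smooth_on_iterate[OF r(1) s] D unfolding real_differentiable_def by blast+
      then show ?thesis
        unfolding c'_def[abs_def] using r(2)[OF s]
        by (intro differentiable_add differentiable_divide differentiable_power) auto
    qed
    then obtain E where E: "(c' has_real_derivative E) (at s)"
      unfolding real_differentiable_def by blast
    let ?F = "deriv r s * c' s + E * r s"
    have rf: "((\<lambda>t. r t * c' t) has_real_derivative ?F) (at s)"
      by (rule DERIV_mult[OF dr[OF s] E])
    have "lap r (mean_curv x y r) s 0 $ 3 = (1/2 * ?F / r s + -1 * (1/2 * c s) / (r s)^2) * cos 0"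
      unfolding lap_def vec_lambda_beta
    proof (rule lap_scalar_separated[OF I(1) s H3 _ _ cos])
      show "((\<lambda>s. 1/2 * c s) has_real_derivative 1/2 * c' u) (at u)" if "u \<in> I" for u
        by (rule DERIV_cmult[OF dc[OF that]])
      show "((\<lambda>u. r u * (1/2 * c' u)) has_real_derivative 1/2 * ?F) (at s)"
        using DERIV_cmult[OF rf, of "1/2"] by (simp add: mult_ac)
    qed
    then have "1/2 * ?F / r s + -1 * (1/2 * c s) / (r s)^2 = 0"
      using assms(9) s by simp
    then have "?F = c s / r s"
      using r(2)[OF s] by (simp add: field_simps power2_eq_square)
    with rf show ?thesis by simp
  qed
  obtain A where A: "\<And>s. s \<in> I \<Longrightarrow> r s * radial_lap' r x s = A"
    using constant_of_zero_derivative[OF I(2) flux0[OF x H1]] by blast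
  obtain B where B: "\<And>s. s \<in> I \<Longrightarrow> r s * radial_lap' r y s = B"
    using constant_of_zero_derivative[OF I(2) flux0[OF y H2]] by blast
  have "continuous_on I (\<lambda>s. 1 / r s)"
    using dr r(2) by (intro continuous_intros DERIV_continuous_on[of I r "deriv r"])
      (auto intro: has_field_derivative_at_within simp: less_imp_neq[THEN not_sym])
  then obtain t where t: "\<And>s. s \<in> I \<Longrightarrow> (t has_real_derivative 1 / r s) (at s)"
    by (rule antiderivative_open_interval[OF I]) blast
  interpret biharmonic_profile I t r "\<lambda>s. r s * deriv r s" "\<lambda>s. r s * deriv x s" "\<lambda>s. r s * deriv y s"
    "radial_lap r x" "radial_lap r y" c "\<lambda>s. r s * c' s" A B
  proof
    fix s assume s: "s \<in> I"
    then have pos: "r s > 0" by (rule r(2))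
    then have square: "(r s)^2 * v / r s = r s * v" for v
      by (simp add: power2_eq_square)
    have "(r s + (r s)^2 * c s) / r s = r s * radial_lap r r s"
      using pos by (simp add: c_def field_simps power2_eq_square)
    with DERIV_radial_flux[OF r r(1) s]
    show "((\<lambda>s. r s * deriv r s) has_real_derivative (r s + (r s)^2 * c s) / r s) (at s)"
      by simp
    show "((\<lambda>s. r s * deriv x s) has_real_derivative (r s)^2 * radial_lap r x s / r s) (at s)"
      using DERIV_radial_flux[OF r x s] by (simp only: square)
    show "((\<lambda>s. r s * deriv y s) has_real_derivative (r s)^2 * radial_lap r y s / r s) (at s)"
      using DERIV_radial_flux[OF r y s] by (simp only: square)
    have "A / r s = radial_lap' r x s" "B / r s = radial_lap' r y s"
      using A[OF s] B[OF s] pos by auto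
    then show "(radial_lap r x has_real_derivative A / r s) (at s)"
      "(radial_lap r y has_real_derivative B / r s) (at s)"
      using DERIV_radial_lap[OF r x s] DERIV_radial_lap[OF r y s] by simp_all
    show "(c has_real_derivative r s * c' s / r s) (at s)"
      using dc[OF s] pos by simp
    show "(r has_real_derivative r s * deriv r s / r s) (at s)"
      using dr[OF s] pos by simp
    show "(r s * deriv x s)^2 + (r s * deriv y s)^2 + (r s * deriv r s)^2 = (r s)^2"
    proof -
      have "(r s * deriv x s)^2 + (r s * deriv y s)^2 + (r s * deriv r s)^2
          = (r s)^2 * ((deriv x s)^2 + (deriv y s)^2 + (deriv r s)^2)"
        by (simp add: power_mult_distrib distrib_left)
      then show ?thesis
        using assms(8) s by simp
    qed
  qed (use I r t dd in auto)
  show ?thesis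
  proof (intro ballI allI)
    fix s \<theta> assume s: "s \<in> I"
    show "mean_curv x y r s \<theta> = 0"
      using mean_curvature_components_0[OF s] H1[OF s] H2[OF s] H3[OF s] H4[OF s]
      by (simp add: vec_eq_iff forall_4)
  qed
qed

end
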